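(* Let $(X,\precsim)$ be a preordered set. Then the preordered set $(\mathscr G/{\cong},\rightsquigarrow)$ of isomorphism classes of finitely generated groups contains $(X,\precsim)$ as a subpreorder if and only if both of the following hold: (i) $X$ has cardinality at most that of the continuum; (ii) there is a countable set $\mathscr B$ such that every partial order contained in $X$ (that is, every subset $Y\subseteq X$ on which $\precsim$ is antisymmetric, with the restricted relation) is imbeddable in the partially ordered set of subsets of $\mathscr B$ under inclusion.
   Context: For finitely generated groups $G,H$, write $G\rightsquigarrow H$ ("$G$ preforms $H$") if there exist a finite generating set $T$ of $H$ and a sequence $S_1,S_2,\dots$ of finite generating sets of $G$, with bijections $S_n\to T$, such that for every $R\in\mathbb N$ and all $n$ large enough the balls of radius $R$ around the identity in the Cayley graphs of $(G,S_n)$ and $(H,T)$ are isomorphic as rooted graphs with edges labelled by generators, labels being identified via $S_n\to T$. The relation $\rightsquigarrow$ is a preorder (reflexive and transitive) on the set $\mathscr G/{\cong}$ of isomorphism classes of finitely generated groups. A preordered set $(X,\precsim)$ imbeds in (is contained as a subpreorder of) $(X',\precsim')$ if there is an injective map $f:X\to X'$ such that $x\precsim y\iff f(x)\precsim' f(y)$ for all $x,y\in X$. *)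

theory Defs
  imports
    Complex_Main
    "HOL-Algebra.Generated_Groups"
    "HOL-Library.Countable_Set"
    "HOL-Library.Equipollence"
begin

section \<open>Rooted graphs with labelled edges\<close>

text \<open>An arc \<open>(u, l, v)\<close> leads from \<open>u\<close> to \<open>v\<close> and carries the label \<open>l\<close>.\<close>

record ('v, 'l) rooted_graph =
  verts :: "'v set"
  arcs :: "('v \<times> 'l \<times> 'v) set"
  root :: 'v

definition adjacency :: "('v, 'l) rooted_graph \<Rightarrow> 'v rel" where
  "adjacency \<Gamma> = {(u, v). \<exists>l. (u, l, v) \<in> arcs \<Gamma> \<or> (v, l, u) \<in> arcs \<Gamma>}"

text \<open>
  The vertices at undirected path distance at most \<open>R\<close> from the root, with all arcs between them.
\<close>

definition ball_verts :: "('v, 'l) rooted_graph \<Rightarrow> nat \<Rightarrow> 'v set" where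
  "ball_verts \<Gamma> R = {v. \<exists>n\<le>R. (root \<Gamma>, v) \<in> adjacency \<Gamma> ^^ n}"

definition root_ball :: "('v, 'l) rooted_graph \<Rightarrow> nat \<Rightarrow> ('v, 'l) rooted_graph" where
  "root_ball \<Gamma> R =
     \<lparr>verts = ball_verts \<Gamma> R,
      arcs = {(u, l, v) \<in> arcs \<Gamma>. u \<in> ball_verts \<Gamma> R \<and> v \<in> ball_verts \<Gamma> R},
      root = root \<Gamma>\<rparr>"

text \<open>
  Isomorphism of rooted graphs, where \<open>\<phi>\<close> says which label of the second graph a label of the
  first one is identified with. It is meant for \<open>\<phi>\<close> injective on the labels; the map on arcs
  is then a bijection.
\<close>

definition isomorphic_via ::
    "('l \<Rightarrow> 'm) \<Rightarrow> ('v, 'l) rooted_graph \<Rightarrow> ('w, 'm) rooted_graph \<Rightarrow> bool" where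
  "isomorphic_via \<phi> \<Gamma> \<Delta> \<longleftrightarrow>
     (\<exists>f. bij_betw f (verts \<Gamma>) (verts \<Delta>) \<and> f (root \<Gamma>) = root \<Delta> \<and>
          arcs \<Delta> = (\<lambda>(u, l, v). (f u, \<phi> l, f v)) ` arcs \<Gamma>)"


section \<open>Finitely generated groups and the relation \<open>preforms\<close>\<close>

definition finite_generating_set :: "('a, 'c) monoid_scheme \<Rightarrow> 'a set \<Rightarrow> bool" where
  "finite_generating_set G S \<longleftrightarrow> finite S \<and> S \<subseteq> carrier G \<and> generate G S = carrier G"

definition finitely_generated_group :: "('a, 'c) monoid_scheme \<Rightarrow> bool" where
  "finitely_generated_group G \<longleftrightarrow> group G \<and> (\<exists>S. finite_generating_set G S)"

definition cayley_graph :: "('a, 'c) monoid_scheme \<Rightarrow> 'a set \<Rightarrow> ('a, 'a) rooted_graph" where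
  "cayley_graph G S =
     \<lparr>verts = carrier G,
      arcs = {(g, s, g \<otimes>\<^bsub>G\<^esub> s) | g s. g \<in> carrier G \<and> s \<in> S},
      root = \<one>\<^bsub>G\<^esub>\<rparr>"

definition preforms :: "('a, 'c) monoid_scheme \<Rightarrow> ('b, 'd) monoid_scheme \<Rightarrow> bool" where
  "preforms G H \<longleftrightarrow>
     (\<exists>T S \<phi>. finite_generating_set H T \<and>
        (\<forall>n::nat. finite_generating_set G (S n) \<and> bij_betw (\<phi> n) (S n) T) \<and>
        (\<forall>R. \<forall>\<^sub>F n in sequentially.
           isomorphic_via (\<phi> n) (root_ball (cayley_graph G (S n)) R)
                                (root_ball (cayley_graph H T) R)))"


section \<open>The preordered set of isomorphism classes of finitely generated groups\<close>

text \<open>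
  Finitely generated groups are countable, so each of them is isomorphic to one whose carrier is
  a set of natural numbers (\<open>finitely_generated_group_has_nat_copy\<close> below).
\<close>

definition fg_groups :: "nat monoid set" where
  "fg_groups = {G. finitely_generated_group G}"

definition fg_iso :: "nat monoid rel" where
  "fg_iso = {(G, H). G \<in> fg_groups \<and> H \<in> fg_groups \<and> G \<cong> H}"

definition fg_classes :: "nat monoid set set" where
  "fg_classes = fg_groups // fg_iso"

text \<open>
  The choice of representatives is irrelevant by \<open>preforms_iso_cong\<close> below.
\<close>

definition preforms_classes :: "nat monoid set rel" where
  "preforms_classes =
     {(A, B). A \<in> fg_classes \<and> B \<in> fg_classes \<and> (\<exists>G\<in>A. \<exists>H\<in>B. preforms G H)}"


section \<open>Imbeddings of preordered sets\<close>

definition preorder_imbeds :: "'a set \<Rightarrow> 'a rel \<Rightarrow> 'b set \<Rightarrow> 'b rel \<Rightarrow> bool" where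
  "preorder_imbeds X r X' r' \<longleftrightarrow>
     (\<exists>f. inj_on f X \<and> f ` X \<subseteq> X' \<and> (\<forall>x\<in>X. \<forall>y\<in>X. (x, y) \<in> r \<longleftrightarrow> (f x, f y) \<in> r'))"

definition inclusion_on :: "'a set \<Rightarrow> 'a set rel" where
  "inclusion_on B = {(U, V). U \<subseteq> V \<and> V \<subseteq> B}"


section \<open>Adequacy of the representation by groups on natural numbers\<close>

lemma fg_iso_equiv: "equiv fg_groups fg_iso"
proof (rule equivI)
  show "fg_iso \<subseteq> fg_groups \<times> fg_groups" by (auto simp: fg_iso_def)
  show "refl_on fg_groups fg_iso"
    unfolding refl_on_def fg_iso_def by (auto intro: iso_refl)
  show "sym fg_iso"
    unfolding sym_def fg_iso_def fg_groups_def finitely_generated_group_def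
    by (auto intro: group.iso_sym)
  show "trans fg_iso"
    unfolding trans_def fg_iso_def by (auto intro: iso_trans)
qed

lemma generate_countable:
  assumes "group G" "S \<subseteq> carrier G" "countable S"
  shows "countable (generate G S)"
proof -
  interpret group G by fact
  define A where "A = S \<union> (\<lambda>s. inv\<^bsub>G\<^esub> s) ` S"
  define val where "val = (\<lambda>xs. foldr (\<lambda>x y. x \<otimes>\<^bsub>G\<^esub> y) xs \<one>\<^bsub>G\<^esub>)"
  have A: "A \<subseteq> carrier G" and cA: "countable A"
    using assms by (auto simp: A_def)
  have val_closed: "val xs \<in> carrier G" if "xs \<in> lists A" for xs
    using that A by (induction xs) (auto simp: val_def)
  have val_append: "val (xs @ ys) = val xs \<otimes>\<^bsub>G\<^esub> val ys" if "xs \<in> lists A" "ys \<in> lists A" for xs ys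
    using that(1)
  proof (induction xs)
    case Nil
    then show ?case using val_closed[OF that(2)] by (simp add: val_def)
  next
    case (Cons x xs)
    have "x \<in> carrier G" using Cons A by auto
    moreover have "val (x # zs) = x \<otimes>\<^bsub>G\<^esub> val zs" for zs by (simp add: val_def)
    ultimately show ?case
      using Cons.IH val_closed[OF Cons.hyps(2)] val_closed[OF that(2)] by (simp add: m_assoc)
  qed
  have val_single: "val [x] = x" if "x \<in> A" for x
    using that A by (auto simp: val_def)
  have "generate G S \<subseteq> val ` lists A"
  proof
    fix x assume "x \<in> generate G S"
    then show "x \<in> val ` lists A"
    proof induction
      case one
      have "\<one>\<^bsub>G\<^esub> = val []" by (simp add: val_def)
      then show ?case by blast
    next
      case (incl h)
      then have "h \<in> A" by (simp add: A_def)
      then show ?case by (intro image_eqI[of _ _ "[h]"]) (simp_all add: val_single)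
    next
      case (inv h)
      then have "inv\<^bsub>G\<^esub> h \<in> A" by (simp add: A_def)
      then show ?case by (intro image_eqI[of _ _ "[inv\<^bsub>G\<^esub> h]"]) (simp_all add: val_single)
    next
      case (eng h1 h2)
      then obtain xs ys where *: "xs \<in> lists A" "ys \<in> lists A" "h1 = val xs" "h2 = val ys" by blast
      then show ?case by (intro image_eqI[of _ _ "xs @ ys"]) (simp_all add: val_append)
    qed
  qed
  then show ?thesis
    using countable_subset countable_image countable_lists[OF cA] by metis
qed

lemma iso_finite_generating_set:
  assumes "group G" "group H" "h \<in> iso G H" "finite_generating_set G S"
  shows "finite_generating_set H (h ` S)"
proof -
  interpret group_hom G H h
    using assms by (simp add: group_hom_def group_hom_axioms_def iso_def)
  have "h ` carrier G = carrier H" using assms(3) by (auto simp: iso_def bij_betw_def)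
  then show ?thesis
    using assms(4) generate_img[of S] by (auto simp: finite_generating_set_def)
qed

lemma finitely_generated_group_has_nat_copy:
  assumes "finitely_generated_group G"
  shows "\<exists>H\<in>fg_groups. G \<cong> H"
proof -
  obtain S where G: "group G" and S: "finite_generating_set G S"
    using assms by (auto simp: finitely_generated_group_def)
  interpret group G by fact
  have "countable (carrier G)"
    using generate_countable[OF G, of S] S by (auto simp: finite_generating_set_def countable_finite)
  then obtain e :: "_ \<Rightarrow> nat" where e: "inj_on e (carrier G)"
    by (auto simp: countable_def)
  define d where "d = inv_into (carrier G) e"
  have d: "d (e x) = x" if "x \<in> carrier G" for x
    using e that by (simp add: d_def)
  define H :: "nat monoid" where
    "H = \<lparr>carrier = e ` carrier G, mult = (\<lambda>x y. e (d x \<otimes>\<^bsub>G\<^esub> d y)), one = e \<one>\<^bsub>G\<^esub>\<rparr>"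
  have "monoid H"
    by (unfold_locales) (auto simp: H_def d m_assoc)
  have iso: "e \<in> iso G H"
    using e by (auto simp: iso_def hom_def H_def d bij_betw_def)
  then have "G \<cong> H" by (auto simp: is_iso_def)
  then have "group H" using iso_imp_group \<open>monoid H\<close> by blast
  then have "H \<in> fg_groups"
    using iso_finite_generating_set[OF G _ iso S]
    by (auto simp: fg_groups_def finitely_generated_group_def)
  then show ?thesis using \<open>G \<cong> H\<close> by blast
qed

lemma isomorphic_via_trans:
  assumes "isomorphic_via \<phi> \<Gamma> \<Delta>" "isomorphic_via \<psi> \<Delta> \<Theta>"
  shows "isomorphic_via (\<psi> \<circ> \<phi>) \<Gamma> \<Theta>"
proof -
  obtain f g where f: "bij_betw f (verts \<Gamma>) (verts \<Delta>)" "f (root \<Gamma>) = root \<Delta>"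
      "arcs \<Delta> = (\<lambda>(u, l, v). (f u, \<phi> l, f v)) ` arcs \<Gamma>"
    and g: "bij_betw g (verts \<Delta>) (verts \<Theta>)" "g (root \<Delta>) = root \<Theta>"
      "arcs \<Theta> = (\<lambda>(u, l, v). (g u, \<psi> l, g v)) ` arcs \<Delta>"
    using assms unfolding isomorphic_via_def by blast
  show ?thesis
    unfolding isomorphic_via_def
  proof (intro exI conjI)
    show "bij_betw (g \<circ> f) (verts \<Gamma>) (verts \<Theta>)" using f(1) g(1) by (rule bij_betw_trans)
    show "(g \<circ> f) (root \<Gamma>) = root \<Theta>" using f g by simp
    show "arcs \<Theta> = (\<lambda>(u, l, v). ((g \<circ> f) u, (\<psi> \<circ> \<phi>) l, (g \<circ> f) v)) ` arcs \<Gamma>"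
      unfolding g(3) f(3) image_image by (rule image_cong) auto
  qed
qed

lemma iso_root_ball:
  assumes "group G" "group H" and h: "h \<in> iso G H" and S: "S \<subseteq> carrier G"
  shows "isomorphic_via h (root_ball (cayley_graph G S) R) (root_ball (cayley_graph H (h ` S)) R)"
    (is "isomorphic_via h (root_ball ?\<Gamma> R) (root_ball ?\<Delta> R)")
proof -
  interpret group_hom G H h
    using assms by (simp add: group_hom_def group_hom_axioms_def iso_def)
  have inj: "inj_on h (carrier G)" and surj: "h ` carrier G = carrier H"
    using h by (auto simp: iso_def bij_betw_def)
  have arcs: "arcs ?\<Delta> = (\<lambda>(u, l, v). (h u, h l, h v)) ` arcs ?\<Gamma>"
  proof (rule equalityI[OF subsetI subsetI])
    fix x assume "x \<in> arcs ?\<Delta>"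
    then obtain y s where "y \<in> h ` carrier G" "s \<in> S" "x = (y, h s, y \<otimes>\<^bsub>H\<^esub> h s)"
      unfolding surj by (auto simp: cayley_graph_def)
    then obtain g where "g \<in> carrier G" "s \<in> S" "x = (h g, h s, h g \<otimes>\<^bsub>H\<^esub> h s)"
      by blast
    then have "x = (\<lambda>(u, l, v). (h u, h l, h v)) (g, s, g \<otimes>\<^bsub>G\<^esub> s)" "(g, s, g \<otimes>\<^bsub>G\<^esub> s) \<in> arcs ?\<Gamma>"
      using S by (auto simp: cayley_graph_def)
    then show "x \<in> (\<lambda>(u, l, v). (h u, h l, h v)) ` arcs ?\<Gamma>" by (rule image_eqI)
  next
    fix x assume "x \<in> (\<lambda>(u, l, v). (h u, h l, h v)) ` arcs ?\<Gamma>"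
    then obtain g s where "g \<in> carrier G" "s \<in> S" "x = (h g, h s, h (g \<otimes>\<^bsub>G\<^esub> s))"
      by (auto simp: cayley_graph_def)
    then show "x \<in> arcs ?\<Delta>"
      using S by (auto simp: cayley_graph_def subset_iff)
  qed
  have arcs_in: "u \<in> carrier G" "v \<in> carrier G" if "(u, l, v) \<in> arcs ?\<Gamma>" for u l v
    using that S by (auto simp: cayley_graph_def)
  have adj_in: "u \<in> carrier G" "v \<in> carrier G" if "(u, v) \<in> adjacency ?\<Gamma>" for u v
    using that arcs_in by (auto simp: adjacency_def)
  have adj: "adjacency ?\<Delta> = map_prod h h ` adjacency ?\<Gamma>"
  proof (rule equalityI[OF subsetI subsetI])
    fix x assume "x \<in> adjacency ?\<Delta>"
    then obtain u l v where "(u, l, v) \<in> arcs ?\<Gamma>" "x = (h u, h v) \<or> x = (h v, h u)"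
      unfolding adjacency_def arcs by auto
    then have "x \<in> map_prod h h ` {(u, v), (v, u)}" "{(u, v), (v, u)} \<subseteq> adjacency ?\<Gamma>"
      by (auto simp: adjacency_def)
    then show "x \<in> map_prod h h ` adjacency ?\<Gamma>" by blast
  next
    fix x assume "x \<in> map_prod h h ` adjacency ?\<Gamma>"
    then show "x \<in> adjacency ?\<Delta>"
      unfolding adjacency_def arcs by force
  qed
  have pow_in: "v \<in> carrier G" if "(\<one>\<^bsub>G\<^esub>, v) \<in> adjacency ?\<Gamma> ^^ n" for n v
    using that by (cases n) (auto dest: adj_in)
  have step: "{w. (\<one>\<^bsub>H\<^esub>, w) \<in> adjacency ?\<Delta> ^^ n} = h ` {v. (\<one>\<^bsub>G\<^esub>, v) \<in> adjacency ?\<Gamma> ^^ n}" for n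
  proof (induction n)
    case 0
    then show ?case by auto
  next
    case (Suc n)
    have "{w. (\<one>\<^bsub>H\<^esub>, w) \<in> adjacency ?\<Delta> ^^ Suc n} =
          adjacency ?\<Delta> `` {w. (\<one>\<^bsub>H\<^esub>, w) \<in> adjacency ?\<Delta> ^^ n}" by auto
    also have "\<dots> = h ` (adjacency ?\<Gamma> `` {v. (\<one>\<^bsub>G\<^esub>, v) \<in> adjacency ?\<Gamma> ^^ n})"
    proof (rule equalityI[OF subsetI subsetI])
      fix w assume "w \<in> adjacency ?\<Delta> `` {w. (\<one>\<^bsub>H\<^esub>, w) \<in> adjacency ?\<Delta> ^^ n}"
      then obtain v where v: "(\<one>\<^bsub>G\<^esub>, v) \<in> adjacency ?\<Gamma> ^^ n" and "(h v, w) \<in> adjacency ?\<Delta>"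
        unfolding Suc by blast
      then obtain a b where ab: "(a, b) \<in> adjacency ?\<Gamma>" "h v = h a" "w = h b"
        unfolding adj by auto
      have "v = a" using inj_onD[OF inj ab(2)] pow_in[OF v] adj_in[OF ab(1)] by simp
      then show "w \<in> h ` (adjacency ?\<Gamma> `` {v. (\<one>\<^bsub>G\<^esub>, v) \<in> adjacency ?\<Gamma> ^^ n})"
        using v ab by blast
    next
      fix w assume "w \<in> h ` (adjacency ?\<Gamma> `` {v. (\<one>\<^bsub>G\<^esub>, v) \<in> adjacency ?\<Gamma> ^^ n})"
      then obtain a b where "(a, b) \<in> adjacency ?\<Gamma>" "(\<one>\<^bsub>G\<^esub>, a) \<in> adjacency ?\<Gamma> ^^ n" "w = h b"
        by blast
      moreover from this have "(h a, h b) \<in> adjacency ?\<Delta>" unfolding adj by force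
      ultimately show "w \<in> adjacency ?\<Delta> `` {w. (\<one>\<^bsub>H\<^esub>, w) \<in> adjacency ?\<Delta> ^^ n}"
        unfolding Suc by blast
    qed
    also have "adjacency ?\<Gamma> `` {v. (\<one>\<^bsub>G\<^esub>, v) \<in> adjacency ?\<Gamma> ^^ n} =
          {v. (\<one>\<^bsub>G\<^esub>, v) \<in> adjacency ?\<Gamma> ^^ Suc n}" by auto
    finally show ?case .
  qed
  have roots: "root ?\<Gamma> = \<one>\<^bsub>G\<^esub>" "root ?\<Delta> = \<one>\<^bsub>H\<^esub>" by (simp_all add: cayley_graph_def)
  have bv: "ball_verts ?\<Delta> R = h ` ball_verts ?\<Gamma> R"
  proof -
    have "ball_verts ?\<Delta> R = (\<Union>n\<le>R. {w. (\<one>\<^bsub>H\<^esub>, w) \<in> adjacency ?\<Delta> ^^ n})"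
      by (auto simp: ball_verts_def roots)
    also have "\<dots> = h ` (\<Union>n\<le>R. {v. (\<one>\<^bsub>G\<^esub>, v) \<in> adjacency ?\<Gamma> ^^ n})"
      unfolding step by blast
    also have "(\<Union>n\<le>R. {v. (\<one>\<^bsub>G\<^esub>, v) \<in> adjacency ?\<Gamma> ^^ n}) = ball_verts ?\<Gamma> R"
      by (auto simp: ball_verts_def roots)
    finally show ?thesis .
  qed
  have bv_in: "ball_verts ?\<Gamma> R \<subseteq> carrier G"
    using pow_in by (auto simp: ball_verts_def roots)
  have mem: "h u \<in> h ` ball_verts ?\<Gamma> R \<longleftrightarrow> u \<in> ball_verts ?\<Gamma> R" if "u \<in> carrier G" for u
    using inj_on_image_mem_iff[OF inj that bv_in] .
  show ?thesis
    unfolding isomorphic_via_def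
  proof (intro exI conjI)
    show "bij_betw h (verts (root_ball ?\<Gamma> R)) (verts (root_ball ?\<Delta> R))"
      using inj_on_subset[OF inj bv_in] bv by (simp add: root_ball_def bij_betw_def)
    show "h (root (root_ball ?\<Gamma> R)) = root (root_ball ?\<Delta> R)"
      by (simp add: root_ball_def roots)
    show "arcs (root_ball ?\<Delta> R) = (\<lambda>(u, l, v). (h u, h l, h v)) ` arcs (root_ball ?\<Gamma> R)"
    proof (rule equalityI[OF subsetI subsetI])
      fix x assume "x \<in> arcs (root_ball ?\<Delta> R)"
      then have "x \<in> arcs ?\<Delta>" and x: "fst x \<in> ball_verts ?\<Delta> R" "snd (snd x) \<in> ball_verts ?\<Delta> R"
        by (auto simp: root_ball_def)
      then obtain u l v where a: "(u, l, v) \<in> arcs ?\<Gamma>" "x = (h u, h l, h v)"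
        unfolding arcs by auto
      with x have "(u, l, v) \<in> arcs (root_ball ?\<Gamma> R)"
        using mem arcs_in[OF a(1)] by (simp add: root_ball_def bv)
      then show "x \<in> (\<lambda>(u, l, v). (h u, h l, h v)) ` arcs (root_ball ?\<Gamma> R)"
        using a(2) by force
    next
      fix x assume "x \<in> (\<lambda>(u, l, v). (h u, h l, h v)) ` arcs (root_ball ?\<Gamma> R)"
      then obtain u l v where a: "(u, l, v) \<in> arcs ?\<Gamma>" "x = (h u, h l, h v)"
          "u \<in> ball_verts ?\<Gamma> R" "v \<in> ball_verts ?\<Gamma> R"
        by (auto simp: root_ball_def)
      then have "x \<in> arcs ?\<Delta>" unfolding arcs by force
      then show "x \<in> arcs (root_ball ?\<Delta> R)"
        using a by (simp add: root_ball_def bv)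
    qed
  qed
qed

lemma preforms_iso_cong:
  assumes grp: "group G" "group G'" "group H" "group H'"
    and iso: "G \<cong> G'" "H \<cong> H'" and pre: "preforms G H"
  shows "preforms G' H'"
proof -
  obtain h k where h: "h \<in> iso G G'" and k: "k \<in> iso H H'"
    using iso by (auto simp: is_iso_def)
  define h' where "h' = inv_into (carrier G) h"
  have h': "h' \<in> iso G' G"
    using group.iso_set_sym[OF grp(1) h] by (simp add: h'_def)
  have inj: "inj_on h (carrier G)" "inj_on k (carrier H)" "inj_on h' (carrier G')"
    using h k h' by (auto simp: iso_def bij_betw_def)
  obtain T S \<phi> where T: "finite_generating_set H T"
    and S: "\<And>n::nat. finite_generating_set G (S n)" "\<And>n. bij_betw (\<phi> n) (S n) T"
    and balls: "\<And>R. \<forall>\<^sub>F n in sequentially.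
           isomorphic_via (\<phi> n) (root_ball (cayley_graph G (S n)) R)
                                (root_ball (cayley_graph H T) R)"
    using pre unfolding preforms_def by blast
  have Ssub: "S n \<subseteq> carrier G" "T \<subseteq> carrier H" for n
    using S(1)[of n] T by (auto simp: finite_generating_set_def)
  have gen: "finite_generating_set H' (k ` T)" "finite_generating_set G' (h ` S n)" for n
    by (rule iso_finite_generating_set[OF grp(3,4) k T])
      (rule iso_finite_generating_set[OF grp(1,2) h S(1)])
  have h'h: "h' ` h ` S n = S n" for n
    using inj(1) Ssub(1)[of n] by (simp add: h'_def inv_into_image_cancel)
  have sub': "h ` S n \<subseteq> carrier G'" for n
    using gen(2)[of n] by (simp add: finite_generating_set_def)
  have bij: "bij_betw (k \<circ> (\<phi> n \<circ> h')) (h ` S n) (k ` T)" for n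
  proof (rule bij_betw_trans[OF bij_betw_trans])
    show "bij_betw h' (h ` S n) (S n)"
      using h'h inj_on_subset[OF inj(3) sub'] by (simp add: bij_betw_def)
    show "bij_betw (\<phi> n) (S n) T" by (rule S)
    show "bij_betw k T (k ` T)"
      using inj_on_subset[OF inj(2) Ssub(2)] by (simp add: bij_betw_def)
  qed
  have "\<forall>\<^sub>F n in sequentially.
           isomorphic_via (k \<circ> (\<phi> n \<circ> h')) (root_ball (cayley_graph G' (h ` S n)) R)
                                (root_ball (cayley_graph H' (k ` T)) R)" for R
    using balls[of R]
  proof eventually_elim
    case (elim n)
    have "isomorphic_via h' (root_ball (cayley_graph G' (h ` S n)) R)
            (root_ball (cayley_graph G (S n)) R)"
      using iso_root_ball[OF grp(2,1) h' sub'[of n], of R] h'h by simp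
    from isomorphic_via_trans[OF isomorphic_via_trans[OF this elim]
        iso_root_ball[OF grp(3,4) k Ssub(2), of R]]
    show ?case .
  qed
  then show ?thesis
    unfolding preforms_def using gen bij
    by (intro exI[of _ "k ` T"] exI[of _ "\<lambda>n. h ` S n"]
        exI[of _ "\<lambda>n. k \<circ> (\<phi> n \<circ> h')"] conjI allI)
qed

end

theory Submission
  imports
    Defs
    "HOL-Library.Poly_Mapping"
    "HOL-Library.Infinite_Set"
    "HOL-Computational_Algebra.Primes"
    "HOL-Analysis.Abstract_Topology_2"
begin

text \<open>
  A group \<open>G\<close> preforms \<open>H\<close> iff every finite pattern (which pairs of short words agree) of a marking
  of \<open>H\<close> by generators also occurs for some marking of \<open>G\<close>. As there are only countably many
  patterns, the set of patterns missing from \<open>G\<close> turns \<open>preforms\<close> into inclusion of subsets of a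
  countable set; this gives one direction.

  For the converse, take P. Hall's group \<open>\<Gamma>\<close> of matrices with rows \<open>(1, x, z)\<close>, \<open>(0, t\<^sup>n, y)\<close>,
  \<open>(0, 0, 1)\<close> over \<open>\<int>[t, t\<^sup>-\<^sup>1]\<close>. Its centre is free abelian with basis indexed by \<open>\<int>\<close>, and
  the automorphism multiplying \<open>y\<close> and \<open>z\<close> by \<open>t\<close> shifts this basis. Given a colouring
  \<open>c : \<int> \<rightarrow> \<nat>\<close>, let \<open>\<Gamma>\<^sub>c\<close> be the quotient of \<open>\<Gamma>\<close> in which the \<open>k\<close>-th basis element has order \<open>c k\<close>.
  If every finite word over the colours of \<open>c\<close> occurs in \<open>c\<close>, then the shifted generating sets
  of \<open>\<Gamma>\<^sub>c\<close> approximate \<open>\<Gamma>\<^sub>c\<^sub>'\<close> for each \<open>c'\<close> using only colours of \<open>c\<close>. Conversely torsion passes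
  from \<open>\<Gamma>\<^sub>c\<^sub>'\<close> to \<open>\<Gamma>\<^sub>c\<close> when \<open>\<Gamma>\<^sub>c\<close> preforms \<open>\<Gamma>\<^sub>c\<^sub>'\<close>, so the prime colours are detected. A set
  \<open>A\<close> of naturals is encoded by admitting the colour \<open>p\<^sub>j\<close> iff \<open>j \<notin> A\<close>. The colours 0 and 1 are always
  admitted and are placed arbitrarily on the negative integers; since a countable group has
  countably many markings, this gives continuum many isomorphism classes for every \<open>A\<close>.
\<close>

section \<open>Words and markings\<close>

fun eval_word :: "('a, 'c) monoid_scheme \<Rightarrow> ('l \<Rightarrow> 'a) \<Rightarrow> ('l \<times> bool) list \<Rightarrow> 'a" where
  "eval_word G s [] = \<one>\<^bsub>G\<^esub>"
| "eval_word G s ((l, b) # w) = (if b then s l else inv\<^bsub>G\<^esub> s l) \<otimes>\<^bsub>G\<^esub> eval_word G s w"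

definition word_inverse :: "('l \<times> bool) list \<Rightarrow> ('l \<times> bool) list" where
  "word_inverse w = rev (map (apsnd Not) w)"

text \<open>For rewriting words when the generating set changes: \<open>v\<close> expresses each
  generator of one set through those of the other.\<close>

definition substitute_word ::
    "('m \<Rightarrow> ('l \<times> bool) list) \<Rightarrow> ('m \<times> bool) list \<Rightarrow> ('l \<times> bool) list" where
  "substitute_word v w = concat (map (\<lambda>(l, b). if b then v l else word_inverse (v l)) w)"

definition short_words :: "'l set \<Rightarrow> nat \<Rightarrow> ('l \<times> bool) list set" where
  "short_words L R = {w \<in> lists (L \<times> UNIV). length w \<le> R}"

text \<open>A generating set indexed by a fixed label set, so that generating sets of different
  groups are compared on the same words. Injectivity of \<open>s\<close> matches the bijections
  \<open>S n \<rightarrow> T\<close> in \<open>preforms\<close>.\<close>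

definition marking :: "('a, 'c) monoid_scheme \<Rightarrow> 'l set \<Rightarrow> ('l \<Rightarrow> 'a) \<Rightarrow> bool" where
  "marking G L s \<longleftrightarrow> finite L \<and> inj_on s L \<and> s ` L \<subseteq> carrier G \<and> generate G (s ` L) = carrier G"

text \<open>Two words with equal value are two paths from the root with a common endpoint, so this
  set records which vertices of the ball of radius \<open>R\<close> coincide.\<close>

definition relations_upto ::
    "('a, 'c) monoid_scheme \<Rightarrow> ('l \<Rightarrow> 'a) \<Rightarrow> 'l set \<Rightarrow> nat \<Rightarrow>
      (('l \<times> bool) list \<times> ('l \<times> bool) list) set" where
  "relations_upto G s L R =
     {(w, w') \<in> short_words L R \<times> short_words L R. eval_word G s w = eval_word G s w'}"

lemma short_words_mono: "R \<le> R' \<Longrightarrow> short_words L R \<subseteq> short_words L R'"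
  by (auto simp: short_words_def)

lemma finite_short_words:
  assumes "finite L"
  shows "finite (short_words L R)"
proof (rule finite_subset)
  show "short_words L R \<subseteq> {w. set w \<subseteq> L \<times> UNIV \<and> length w \<le> R}"
    by (auto simp: short_words_def lists_eq_set)
  show "finite {w. set w \<subseteq> L \<times> (UNIV :: bool set) \<and> length w \<le> R}"
    using assms by (intro finite_lists_length_le) simp
qed

lemma relations_upto_eqD:
  assumes "relations_upto G s L R = relations_upto H t L R"
    and "w \<in> short_words L R" "w' \<in> short_words L R"
  shows "eval_word G s w = eval_word G s w' \<longleftrightarrow> eval_word H t w = eval_word H t w'"
  using assms unfolding relations_upto_def by blast

lemma relations_upto_eqI:
  assumes "\<And>w w'. w \<in> short_words L R \<Longrightarrow> w' \<in> short_words L R \<Longrightarrow>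
      eval_word G s w = eval_word G s w' \<longleftrightarrow> eval_word H t w = eval_word H t w'"
  shows "relations_upto G s L R = relations_upto H t L R"
  using assms unfolding relations_upto_def by blast

lemma relations_upto_antimono:
  assumes "relations_upto G s L R' = relations_upto H t L R'" "R \<le> R'"
  shows "relations_upto G s L R = relations_upto H t L R"
  using relations_upto_eqD[OF assms(1)] short_words_mono[OF assms(2), of L]
  by (intro relations_upto_eqI) blast

lemma finite_generating_set_marking: "marking G L s \<Longrightarrow> finite_generating_set G (s ` L)"
  by (auto simp: marking_def finite_generating_set_def)

lemma marking_id: "finite_generating_set G T \<Longrightarrow> marking G T id"
  by (auto simp: marking_def finite_generating_set_def)

lemma lists_word_inverse:
  "w \<in> lists (L \<times> UNIV) \<Longrightarrow> word_inverse w \<in> lists (L \<times> UNIV)"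
  by (induction w) (auto simp: word_inverse_def)

lemma lists_substitute_word:
  assumes "\<And>l. l \<in> L' \<Longrightarrow> v l \<in> lists (L \<times> UNIV)" "w \<in> lists (L' \<times> UNIV)"
  shows "substitute_word v w \<in> lists (L \<times> UNIV)"
  using assms(2)
proof (induction w)
  case (Cons c w)
  then obtain l b where c: "c = (l, b)" "l \<in> L'" by auto
  then have "v l \<in> lists (L \<times> UNIV)" using assms(1) by blast
  moreover from this have "word_inverse (v l) \<in> lists (L \<times> UNIV)" by (rule lists_word_inverse)
  ultimately show ?case using Cons c by (simp add: substitute_word_def)
qed (simp add: substitute_word_def)

lemma length_substitute_word:
  assumes "\<And>l. l \<in> L' \<Longrightarrow> length (v l) \<le> M" "w \<in> lists (L' \<times> UNIV)"
  shows "length (substitute_word v w) \<le> M * length w"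
  using assms(2)
proof (induction w)
  case (Cons c w)
  then obtain l b where c: "c = (l, b)" "l \<in> L'" by auto
  then have "length (v l) \<le> M" using assms(1) by blast
  then show ?case using Cons c by (simp add: substitute_word_def word_inverse_def)
qed (simp add: substitute_word_def)

section \<open>Evaluation of words in groups\<close>

context group
begin

lemma eval_word_closed:
  assumes "s ` L \<subseteq> carrier G" "w \<in> lists (L \<times> UNIV)"
  shows "eval_word G s w \<in> carrier G"
  using assms(2,1) by (induction w) auto

lemma eval_word_append:
  assumes "s ` L \<subseteq> carrier G" "w \<in> lists (L \<times> UNIV)" "w' \<in> lists (L \<times> UNIV)"
  shows "eval_word G s (w @ w') = eval_word G s w \<otimes> eval_word G s w'"
  using assms(2)
proof (induction w)
  case (Cons c w)
  then obtain l b where "c = (l, b)" "s l \<in> carrier G" using assms(1) by auto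
  with Cons show ?case
    using eval_word_closed[OF assms(1,3)] eval_word_closed[OF assms(1), of w]
    by (simp add: m_assoc)
qed (use eval_word_closed[OF assms(1,3)] in simp)

lemma eval_word_snoc:
  assumes "s ` L \<subseteq> carrier G" "w \<in> lists (L \<times> UNIV)" "l \<in> L"
  shows "eval_word G s (w @ [(l, b)]) = eval_word G s w \<otimes> (if b then s l else inv s l)"
proof -
  have "s l \<in> carrier G" using assms by blast
  then show ?thesis using eval_word_append[OF assms(1,2), of "[(l, b)]"] assms(3) by simp
qed

lemma eval_word_inverse:
  assumes "s ` L \<subseteq> carrier G" "w \<in> lists (L \<times> UNIV)"
  shows "eval_word G s (word_inverse w) = inv eval_word G s w"
  using assms(2)
proof (induction w)
  case (Cons c w)
  then obtain l b where c: "c = (l, b)" "l \<in> L" "s l \<in> carrier G" using assms(1) by auto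
  have w: "word_inverse w \<in> lists (L \<times> UNIV)" "eval_word G s w \<in> carrier G"
    using lists_word_inverse[OF Cons.hyps(2)] eval_word_closed[OF assms(1) Cons.hyps(2)] .
  have "eval_word G s (word_inverse (c # w)) =
      eval_word G s (word_inverse w @ [(l, \<not> b)])"
    by (simp add: word_inverse_def c)
  also have "\<dots> = inv eval_word G s (c # w)"
    using eval_word_snoc[OF assms(1) w(1) c(2)] Cons w(2) c by (simp add: inv_mult_group)
  finally show ?case .
qed (simp add: word_inverse_def)

lemma eval_substitute_word:
  assumes "s ` L \<subseteq> carrier G" "\<And>l. l \<in> L' \<Longrightarrow> v l \<in> lists (L \<times> UNIV)"
    and "w \<in> lists (L' \<times> UNIV)"
  shows "eval_word G s (substitute_word v w) = eval_word G (\<lambda>l. eval_word G s (v l)) w"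
  using assms(3)
proof (induction w)
  case (Cons c w)
  then obtain l b where c: "c = (l, b)" "l \<in> L'" by auto
  have v: "v l \<in> lists (L \<times> UNIV)" "word_inverse (v l) \<in> lists (L \<times> UNIV)"
    using assms(2)[OF c(2)] lists_word_inverse by blast+
  have w: "substitute_word v w \<in> lists (L \<times> UNIV)"
    using assms(2) Cons.hyps(2) by (rule lists_substitute_word)
  have "eval_word G s (substitute_word v (c # w)) =
      eval_word G s ((if b then v l else word_inverse (v l)) @ substitute_word v w)"
    by (simp add: substitute_word_def c)
  also have "\<dots> = eval_word G (\<lambda>l. eval_word G s (v l)) (c # w)"
    using eval_word_append[OF assms(1) _ w] v Cons c eval_word_inverse[OF assms(1) v(1)] by simp
  finally show ?case .
qed (simp add: substitute_word_def)

lemma generate_eq_eval_word: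
  assumes "s ` L \<subseteq> carrier G"
  shows "generate G (s ` L) = eval_word G s ` lists (L \<times> UNIV)"
proof
  show "generate G (s ` L) \<subseteq> eval_word G s ` lists (L \<times> UNIV)"
  proof
    fix x assume "x \<in> generate G (s ` L)"
    then show "x \<in> eval_word G s ` lists (L \<times> UNIV)"
    proof induction
      case one
      have "\<one> = eval_word G s []" by simp
      then show ?case by blast
    next
      case (incl h)
      then obtain l where l: "l \<in> L" "h = s l" by blast
      then have "h = eval_word G s [(l, True)]" using assms by auto
      then show ?case by (rule image_eqI) (use l in auto)
    next
      case (inv h)
      then obtain l where l: "l \<in> L" "h = s l" by blast
      then have "s l \<in> carrier G" using assms by blast
      then have "inv h = eval_word G s [(l, False)]" using l by simp
      then show ?case by (rule image_eqI) (use l in auto)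
    next
      case (eng h1 h2)
      then obtain w w' where "w \<in> lists (L \<times> UNIV)" "w' \<in> lists (L \<times> UNIV)"
        "h1 = eval_word G s w" "h2 = eval_word G s w'" by blast
      then show ?case
        using eval_word_append[OF assms] by (intro image_eqI[of _ _ "w @ w'"]) auto
    qed
  qed
  have "eval_word G s w \<in> generate G (s ` L)" if "w \<in> lists (L \<times> UNIV)" for w
    using that
  proof (induction w)
    case (Cons c w)
    then obtain l b where "c = (l, b)" "l \<in> L" by auto
    with Cons show ?case
      using generate.intros(2)[of "s l" "s ` L" G] generate.intros(3)[of "s l" "s ` L" G]
      by (auto intro: generate.eng)
  qed (simp add: generate.one)
  then show "eval_word G s ` lists (L \<times> UNIV) \<subseteq> generate G (s ` L)" by blast
qed

section \<open>Balls in Cayley graphs described by words\<close>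

lemma cayley_ball_verts:
  assumes "s ` L \<subseteq> carrier G"
  shows "ball_verts (cayley_graph G (s ` L)) R = eval_word G s ` short_words L R"
proof -
  let ?adj = "adjacency (cayley_graph G (s ` L))"
  \<comment> \<open>Distance is undirected: crossing an arc forwards multiplies by a generator,
    crossing it backwards by the inverse of one.\<close>
  have adj: "(u, v) \<in> ?adj \<longleftrightarrow> u \<in> carrier G \<and>
      (\<exists>l\<in>L. \<exists>b. v = u \<otimes> (if b then s l else inv s l))" for u v
  proof
    assume "(u, v) \<in> ?adj"
    then consider l where "l \<in> L" "u \<in> carrier G" "v = u \<otimes> s l"
      | l where "l \<in> L" "v \<in> carrier G" "u = v \<otimes> s l"
      by (auto simp: adjacency_def cayley_graph_def)
    then show "u \<in> carrier G \<and> (\<exists>l\<in>L. \<exists>b. v = u \<otimes> (if b then s l else inv s l))"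
    proof cases
      case 1
      then show ?thesis by (auto intro!: bexI[of _ l] exI[of _ True])
    next
      case 2
      then have "s l \<in> carrier G" using assms by blast
      then have "u \<in> carrier G" "v = u \<otimes> inv s l" using 2 by (auto simp: m_assoc)
      then show ?thesis using 2(1) by (auto intro!: bexI[of _ l] exI[of _ False])
    qed
  next
    assume "u \<in> carrier G \<and> (\<exists>l\<in>L. \<exists>b. v = u \<otimes> (if b then s l else inv s l))"
    then obtain l b where *: "u \<in> carrier G" "l \<in> L" "v = u \<otimes> (if b then s l else inv s l)"
      by blast
    then have "s l \<in> carrier G" using assms by blast
    then have "v = u \<otimes> s l \<or> v \<in> carrier G \<and> u = v \<otimes> s l"
      using * by (cases b) (auto simp: m_assoc)
    then show "(u, v) \<in> ?adj"
      using *(1,2) unfolding adjacency_def cayley_graph_def by auto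
  qed
  have pow: "(\<one>, v) \<in> ?adj ^^ n \<longleftrightarrow>
      (\<exists>w \<in> lists (L \<times> UNIV). length w = n \<and> v = eval_word G s w)" for v n
  proof (induction n arbitrary: v)
    case 0
    have "(\<exists>w \<in> lists (L \<times> UNIV). length w = 0 \<and> v = eval_word G s w) \<longleftrightarrow> v = \<one>"
      by (auto intro!: bexI[of _ "[]"])
    then show ?case by auto
  next
    case (Suc n)
    show ?case
    proof
      assume "(\<one>, v) \<in> ?adj ^^ Suc n"
      then obtain w l b where w: "w \<in> lists (L \<times> UNIV)" "length w = n" and l: "l \<in> L"
        and v: "v = eval_word G s w \<otimes> (if b then s l else inv s l)"
        unfolding relpow.simps relcomp_unfold using Suc.IH adj by auto
      have "v = eval_word G s (w @ [(l, b)])" using eval_word_snoc[OF assms w(1) l] v by simp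
      then show "\<exists>w \<in> lists (L \<times> UNIV). length w = Suc n \<and> v = eval_word G s w"
        using w l by (intro bexI[of _ "w @ [(l, b)]"]) auto
    next
      assume "\<exists>w \<in> lists (L \<times> UNIV). length w = Suc n \<and> v = eval_word G s w"
      then obtain w where "w \<in> lists (L \<times> UNIV)" "length w = Suc n" "v = eval_word G s w" by blast
      then obtain w' c where w': "w = w' @ [c]" "length w' = n" by (metis length_Suc_conv_rev)
      obtain l b where c: "c = (l, b)" by fastforce
      then have w'L: "w' \<in> lists (L \<times> UNIV)" "l \<in> L"
        using \<open>w \<in> lists (L \<times> UNIV)\<close> w' by auto
      have "v = eval_word G s w' \<otimes> (if b then s l else inv s l)"
        using \<open>v = eval_word G s w\<close> eval_word_snoc[OF assms w'L] w' c by simp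
      then have "(eval_word G s w', v) \<in> ?adj"
        using adj eval_word_closed[OF assms w'L(1)] w'L(2) by blast
      moreover have "(\<one>, eval_word G s w') \<in> ?adj ^^ n" using Suc.IH w'L(1) w'(2) by blast
      ultimately show "(\<one>, v) \<in> ?adj ^^ Suc n" by auto
    qed
  qed
  have "ball_verts (cayley_graph G (s ` L)) R = {v. \<exists>n\<le>R. (\<one>, v) \<in> ?adj ^^ n}"
    by (simp add: ball_verts_def cayley_graph_def)
  also have "\<dots> = eval_word G s ` short_words L R"
    unfolding pow short_words_def by auto
  finally show ?thesis .
qed

end

lemma (in group_hom) hom_eval_word:
  assumes "s ` L \<subseteq> carrier G" "w \<in> lists (L \<times> UNIV)"
  shows "h (eval_word G s w) = eval_word H (h \<circ> s) w"
  using assms(2)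
proof (induction w)
  case (Cons c w)
  then obtain l b where "c = (l, b)" "s l \<in> carrier G" using assms(1) by auto
  with Cons show ?case using G.eval_word_closed[OF assms(1), of w] by simp
qed simp

lemma (in group) cayley_ball_arcs:
  assumes "s ` L \<subseteq> carrier G"
  shows "arcs (root_ball (cayley_graph G (s ` L)) R) =
    {(eval_word G s w, s l, eval_word G s w') | w l w'. w \<in> short_words L R \<and> l \<in> L \<and>
       w' \<in> short_words L R \<and> eval_word G s w' = eval_word G s (w @ [(l, True)])}"
    (is "?A = ?B")
proof -
  have snoc: "eval_word G s (w @ [(l, True)]) = eval_word G s w \<otimes> s l"
    if "w \<in> short_words L R" "l \<in> L" for w l
    using eval_word_snoc[OF assms, of w l True] that by (simp add: short_words_def)
  have closed: "eval_word G s w \<in> carrier G" if "w \<in> short_words L R" for w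
    using eval_word_closed[OF assms] that by (simp add: short_words_def)
  have A: "?A = {(u, l, v) \<in> arcs (cayley_graph G (s ` L)).
      u \<in> eval_word G s ` short_words L R \<and> v \<in> eval_word G s ` short_words L R}"
    by (simp add: root_ball_def cayley_ball_verts[OF assms])
  show ?thesis
  proof (intro equalityI subsetI)
    fix x assume "x \<in> ?A"
    then obtain w l w' where w: "w \<in> short_words L R" "w' \<in> short_words L R" "l \<in> L"
      and "x = (eval_word G s w, s l, eval_word G s w')" "eval_word G s w' = eval_word G s w \<otimes> s l"
      unfolding A by (auto simp: cayley_graph_def)
    moreover from this have "eval_word G s w' = eval_word G s (w @ [(l, True)])"
      using snoc[OF w(1,3)] by simp
    ultimately show "x \<in> ?B" by blast
  next
    fix x assume "x \<in> ?B"
    then obtain w l w' where w: "w \<in> short_words L R" "w' \<in> short_words L R" "l \<in> L"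
      and "x = (eval_word G s w, s l, eval_word G s w')"
        "eval_word G s w' = eval_word G s (w @ [(l, True)])" by blast
    with snoc[OF w(1,3)] closed[OF w(1)] show "x \<in> ?A"
      unfolding A by (auto simp: cayley_graph_def intro: image_eqI[OF _ w(2)])
  qed
qed

text \<open>The vertex map sends the value of a word in \<open>G\<close> to its value in
  \<open>H\<close>. The radius is \<open>Suc R\<close> because an arc is detected by comparing
  \<open>w'\<close> with \<open>w @ [(l, True)]\<close>, which may have length
  \<open>Suc R\<close>.\<close>

lemma ball_iso_if_same_relations:
  assumes G: "group G" "s ` L \<subseteq> carrier G" and H: "group H" "t ` L \<subseteq> carrier H"
    and \<phi>: "\<And>l. l \<in> L \<Longrightarrow> \<phi> (s l) = t l"
    and rel: "relations_upto G s L (Suc R) = relations_upto H t L (Suc R)"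
  shows "isomorphic_via \<phi> (root_ball (cayley_graph G (s ` L)) R)
    (root_ball (cayley_graph H (t ` L)) R)"
proof -
  let ?W = "short_words L R"
  define f where "f v = eval_word H t (SOME w. w \<in> ?W \<and> eval_word G s w = v)" for v
  have same: "eval_word G s w = eval_word G s w' \<longleftrightarrow> eval_word H t w = eval_word H t w'"
    if "w \<in> short_words L (Suc R)" "w' \<in> short_words L (Suc R)" for w w'
    using relations_upto_eqD[OF rel that] .
  have W: "?W \<subseteq> short_words L (Suc R)" by (rule short_words_mono) simp
  have f: "f (eval_word G s w) = eval_word H t w" if "w \<in> ?W" for w
  proof -
    define w' where "w' = (SOME w'. w' \<in> ?W \<and> eval_word G s w' = eval_word G s w)"
    have "w' \<in> ?W \<and> eval_word G s w' = eval_word G s w"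
      unfolding w'_def by (rule someI[of _ w]) (simp add: that)
    then show ?thesis using same[of w' w] that W by (auto simp: f_def w'_def)
  qed
  have verts: "verts (root_ball (cayley_graph G (s ` L)) R) = eval_word G s ` ?W"
    "verts (root_ball (cayley_graph H (t ` L)) R) = eval_word H t ` ?W"
    using group.cayley_ball_verts[OF G, of R] group.cayley_ball_verts[OF H, of R]
    by (simp_all add: root_ball_def)
  have nil: "[] \<in> ?W" by (simp add: short_words_def)
  have snoc: "w @ [(l, True)] \<in> short_words L (Suc R)" if "w \<in> ?W" "l \<in> L" for w l
    using that by (simp add: short_words_def)
  show ?thesis
    unfolding isomorphic_via_def
  proof (intro exI[of _ f] conjI)
    have "inj_on f (eval_word G s ` ?W)"
    proof (rule inj_onI)
      fix u v assume "u \<in> eval_word G s ` ?W" "v \<in> eval_word G s ` ?W" "f u = f v"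
      then obtain w w' where w: "w \<in> ?W" "w' \<in> ?W" "u = eval_word G s w" "v = eval_word G s w'"
        by blast
      then show "u = v" using \<open>f u = f v\<close> f[OF w(1)] f[OF w(2)] same[of w w'] W by auto
    qed
    moreover have "f ` eval_word G s ` ?W = eval_word H t ` ?W"
      unfolding image_image by (rule image_cong) (simp_all add: f)
    ultimately show "bij_betw f (verts (root_ball (cayley_graph G (s ` L)) R))
        (verts (root_ball (cayley_graph H (t ` L)) R))"
      unfolding verts bij_betw_def by blast
    show "f (root (root_ball (cayley_graph G (s ` L)) R)) =
        root (root_ball (cayley_graph H (t ` L)) R)"
      using f[OF nil] by (simp add: root_ball_def cayley_graph_def)
    have "(\<lambda>(u, l, v). (f u, \<phi> l, f v)) ` arcs (root_ball (cayley_graph G (s ` L)) R) =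
        {(f (eval_word G s w), \<phi> (s l), f (eval_word G s w')) | w l w'. w \<in> ?W \<and> l \<in> L \<and>
          w' \<in> ?W \<and> eval_word G s w' = eval_word G s (w @ [(l, True)])}"
      unfolding group.cayley_ball_arcs[OF G]
    proof (intro equalityI subsetI)
      fix x assume "x \<in> {(f (eval_word G s w), \<phi> (s l), f (eval_word G s w')) | w l w'. w \<in> ?W \<and> l \<in> L \<and>
          w' \<in> ?W \<and> eval_word G s w' = eval_word G s (w @ [(l, True)])}"
      then obtain w l w' where w: "w \<in> ?W" "l \<in> L" "w' \<in> ?W"
          "eval_word G s w' = eval_word G s (w @ [(l, True)])"
        and "x = (\<lambda>(u, l, v). (f u, \<phi> l, f v)) (eval_word G s w, s l, eval_word G s w')"
        by auto
      from this(5) show "x \<in> (\<lambda>(u, l, v). (f u, \<phi> l, f v)) `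
          {(eval_word G s w, s l, eval_word G s w') | w l w'. w \<in> ?W \<and> l \<in> L \<and>
            w' \<in> ?W \<and> eval_word G s w' = eval_word G s (w @ [(l, True)])}"
        by (rule image_eqI) (use w in blast)
    qed auto
    also have "\<dots> = {(eval_word H t w, t l, eval_word H t w') | w l w'. w \<in> ?W \<and> l \<in> L \<and>
          w' \<in> ?W \<and> eval_word H t w' = eval_word H t (w @ [(l, True)])}"
    proof -
      have "x = (f (eval_word G s w), \<phi> (s l), f (eval_word G s w')) \<and> w \<in> ?W \<and> l \<in> L \<and>
          w' \<in> ?W \<and> eval_word G s w' = eval_word G s (w @ [(l, True)]) \<longleftrightarrow>
        x = (eval_word H t w, t l, eval_word H t w') \<and> w \<in> ?W \<and> l \<in> L \<and>
          w' \<in> ?W \<and> eval_word H t w' = eval_word H t (w @ [(l, True)])" for x w l w'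
      proof (cases "w \<in> ?W \<and> l \<in> L \<and> w' \<in> ?W")
        case True
        then have "w' \<in> short_words L (Suc R)" using W by blast
        then show ?thesis using same[OF _ snoc, of w' w l] f \<phi> True by simp
      qed blast
      then show ?thesis by (intro Collect_cong ex_cong1)
    qed
    finally show "arcs (root_ball (cayley_graph H (t ` L)) R) =
        (\<lambda>(u, l, v). (f u, \<phi> l, f v)) ` arcs (root_ball (cayley_graph G (s ` L)) R)"
      unfolding group.cayley_ball_arcs[OF H] by simp
  qed
qed

text \<open>An isomorphism respecting root and labels carries the path spelled by a word to the path
  spelled by the same word, so \<open>f\<close> takes values in \<open>G\<close> to values in
  \<open>H\<close>; injectivity of \<open>f\<close> does the rest.\<close>

lemma same_relations_if_ball_iso:
  assumes G: "group G" "s ` L \<subseteq> carrier G" and H: "group H" "t ` L \<subseteq> carrier H"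
    and \<phi>: "\<And>l. l \<in> L \<Longrightarrow> \<phi> (s l) = t l"
    and iso: "isomorphic_via \<phi> (root_ball (cayley_graph G (s ` L)) R)
      (root_ball (cayley_graph H (t ` L)) R)"
  shows "relations_upto G s L R = relations_upto H t L R"
proof -
  interpret G: group G by fact
  interpret H: group H by fact
  let ?W = "short_words L R"
  have verts: "verts (root_ball (cayley_graph G (s ` L)) R) = eval_word G s ` ?W"
    using G.cayley_ball_verts[OF G(2), of R] by (simp add: root_ball_def)
  obtain f where inj: "inj_on f (eval_word G s ` ?W)" and one: "f \<one>\<^bsub>G\<^esub> = \<one>\<^bsub>H\<^esub>"
    and arcs: "arcs (root_ball (cayley_graph H (t ` L)) R) =
      (\<lambda>(u, l, v). (f u, \<phi> l, f v)) ` arcs (root_ball (cayley_graph G (s ` L)) R)"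
    using iso unfolding isomorphic_via_def bij_betw_def verts
    by (auto simp: root_ball_def cayley_graph_def)
  have edge: "f v = f u \<otimes>\<^bsub>H\<^esub> t l \<and> f u \<in> carrier H"
    if "u \<in> eval_word G s ` ?W" "v \<in> eval_word G s ` ?W" "l \<in> L" "u \<in> carrier G"
      "v = u \<otimes>\<^bsub>G\<^esub> s l" for u v l
  proof -
    have "(u, s l, v) \<in> arcs (root_ball (cayley_graph G (s ` L)) R)"
      using that unfolding root_ball_def G.cayley_ball_verts[OF G(2)] by (simp add: cayley_graph_def)
    then have "(f u, t l, f v) \<in> arcs (root_ball (cayley_graph H (t ` L)) R)"
      unfolding arcs using \<phi>[OF that(3)] by force
    then show ?thesis by (auto simp: root_ball_def cayley_graph_def)
  qed
  have f: "f (eval_word G s w) = eval_word H t w" if "w \<in> ?W" for w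
    using that
  proof (induction w rule: rev_induct)
    case Nil
    show ?case using one by simp
  next
    case (snoc c w)
    obtain l b where c: "c = (l, b)" by fastforce
    have w: "w \<in> ?W" "w \<in> lists (L \<times> UNIV)" "l \<in> L" using snoc.prems c by (auto simp: short_words_def)
    let ?u = "eval_word G s w" and ?v = "eval_word G s (w @ [(l, b)])"
    have uv: "?u \<in> eval_word G s ` ?W" "?v \<in> eval_word G s ` ?W"
      using w(1) snoc.prems c by auto
    have u: "?u \<in> carrier G" and sl: "s l \<in> carrier G" "t l \<in> carrier H"
      using G.eval_word_closed[OF G(2) w(2)] G(2) H(2) w(3) by auto
    have v: "?v = ?u \<otimes>\<^bsub>G\<^esub> (if b then s l else inv\<^bsub>G\<^esub> s l)"
      by (rule G.eval_word_snoc[OF G(2) w(2,3)])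
    have IH: "f ?u = eval_word H t w" by (rule snoc.IH[OF w(1)])
    have "f ?v = f ?u \<otimes>\<^bsub>H\<^esub> (if b then t l else inv\<^bsub>H\<^esub> t l)"
    proof (cases b)
      case True
      then show ?thesis using edge[OF uv w(3) u] v by simp
    next
      case False
      \<comment> \<open>An inverse letter crosses the arc from \<open>?v\<close> to
        \<open>?u\<close> backwards.\<close>
      have "?u = ?v \<otimes>\<^bsub>G\<^esub> s l" "?v \<in> carrier G" using v False u sl by (simp_all add: G.m_assoc)
      then have "f ?u = f ?v \<otimes>\<^bsub>H\<^esub> t l \<and> f ?v \<in> carrier H" using edge[OF uv(2,1) w(3)] by blast
      then show ?thesis using False sl by (simp add: H.m_assoc)
    qed
    then show ?case using IH H.eval_word_snoc[OF H(2) w(2,3)] c by simp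
  qed
  show ?thesis
  proof (rule relations_upto_eqI)
    fix w w' assume w: "w \<in> ?W" "w' \<in> ?W"
    have "eval_word G s w = eval_word G s w' \<longleftrightarrow> f (eval_word G s w) = f (eval_word G s w')"
      using inj_on_eq_iff[OF inj] w by blast
    then show "eval_word G s w = eval_word G s w' \<longleftrightarrow> eval_word H t w = eval_word H t w'"
      using f w by simp
  qed
qed

section \<open>Approximation by markings, and its independence of the marking\<close>

definition approximates ::
    "('a, 'c) monoid_scheme \<Rightarrow> ('b, 'd) monoid_scheme \<Rightarrow> 'l set \<Rightarrow> ('l \<Rightarrow> 'b) \<Rightarrow> bool" where
  "approximates G H L t \<longleftrightarrow>
     (\<forall>R. \<exists>s. marking G L s \<and> relations_upto G s L R = relations_upto H t L R)"

lemma preforms_imp_approximates: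
  assumes G: "group G" and H: "group H" and "preforms G H"
  shows "\<exists>T. finite_generating_set H T \<and> approximates G H T id"
proof -
  obtain T S \<phi> where T: "finite_generating_set H T"
    and S: "\<And>n::nat. finite_generating_set G (S n)" "\<And>n. bij_betw (\<phi> n) (S n) T"
    and balls: "\<And>R. \<forall>\<^sub>F n in sequentially.
           isomorphic_via (\<phi> n) (root_ball (cayley_graph G (S n)) R)
                                (root_ball (cayley_graph H T) R)"
    using assms(3) unfolding preforms_def by blast
  have "\<exists>s. marking G T s \<and> relations_upto G s T R = relations_upto H id T R" for R
  proof -
    obtain n where n: "isomorphic_via (\<phi> n) (root_ball (cayley_graph G (S n)) R)
        (root_ball (cayley_graph H T) R)"
      using eventually_happens[OF balls] by auto
    \<comment> \<open>The elements of \<open>T\<close> serve as labels, and \<open>s\<close> sends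
      each to the generator of \<open>G\<close> matched with it.\<close>
    define s where "s = inv_into (S n) (\<phi> n)"
    have s: "bij_betw s T (S n)" unfolding s_def by (rule bij_betw_inv_into[OF S(2)])
    have \<phi>: "\<phi> n (s l) = l" if "l \<in> T" for l
      using bij_betw_inv_into_right[OF S(2)] that by (simp add: s_def)
    have sT: "s ` T = S n" using s by (simp add: bij_betw_def)
    have "marking G T s"
      using s S(1)[of n] T sT by (simp add: marking_def finite_generating_set_def bij_betw_def)
    moreover have "relations_upto G s T R = relations_upto H id T R"
      using n S(1)[of n] T \<phi> sT
      by (intro same_relations_if_ball_iso[OF G _ H, where \<phi> = "\<phi> n"])
        (auto simp: finite_generating_set_def)
    ultimately show ?thesis by blast
  qed
  then show ?thesis using T unfolding approximates_def by blast
qed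

lemma approximates_imp_preforms:
  assumes G: "group G" and H: "group H" and t: "marking H L t" and "approximates G H L t"
  shows "preforms G H"
proof -
  \<comment> \<open>One marking for each radius; they form the sequence of generating sets, the
    \<open>n\<close>-th of which handles all balls of radius less than \<open>n\<close>.\<close>
  obtain s where s: "\<And>R. marking G L (s R)"
      "\<And>R. relations_upto G (s R) L R = relations_upto H t L R"
    using assms(4) unfolding approximates_def by metis
  define \<phi> where "\<phi> n = t \<circ> inv_into L (s n)" for n
  have \<phi>: "\<phi> n (s n l) = t l" if "l \<in> L" for n l
    using s(1)[of n] that by (simp add: \<phi>_def marking_def)
  have bij: "bij_betw (\<phi> n) (s n ` L) (t ` L)" for n
  proof -
    have "bij_betw (s n) L (s n ` L)" "bij_betw t L (t ` L)"
      using s(1)[of n] t by (auto simp: marking_def bij_betw_def)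
    then show ?thesis unfolding \<phi>_def by (blast intro: bij_betw_trans bij_betw_inv_into)
  qed
  have "isomorphic_via (\<phi> n) (root_ball (cayley_graph G (s n ` L)) R)
      (root_ball (cayley_graph H (t ` L)) R)" if "n \<ge> Suc R" for n R
  proof (rule ball_iso_if_same_relations[OF G _ H])
    show "relations_upto G (s n) L (Suc R) = relations_upto H t L (Suc R)"
      using relations_upto_antimono[OF s(2) that] .
  qed (use s(1)[of n] t \<phi> in \<open>auto simp: marking_def\<close>)
  then have "\<forall>\<^sub>F n in sequentially. isomorphic_via (\<phi> n) (root_ball (cayley_graph G (s n ` L)) R)
      (root_ball (cayley_graph H (t ` L)) R)" for R
    unfolding eventually_sequentially by blast
  then show ?thesis
    unfolding preforms_def
    using bij finite_generating_set_marking[OF t] finite_generating_set_marking[OF s(1)]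
    by (intro exI[of _ "t ` L"] exI[of _ "\<lambda>n. s n ` L"] exI[of _ \<phi>]) simp
qed

lemma marking_if_relations:
  assumes G: "group G" and s: "marking G L s"
    and L': "finite L'" "inj_on s' L'"
    and v: "\<And>l. l \<in> L' \<Longrightarrow> s' l \<in> carrier G"
    and u: "\<And>l. l \<in> L \<Longrightarrow> u l \<in> lists (L' \<times> UNIV) \<and> eval_word G s' (u l) = s l"
  shows "marking G L' s'"
proof -
  interpret group G by fact
  have sub: "s' ` L' \<subseteq> carrier G" using v by blast
  have "s ` L \<subseteq> generate G (s' ` L')"
    unfolding generate_eq_eval_word[OF sub] using u by force
  then have "generate G (s ` L) \<subseteq> generate G (s' ` L')"
    using generate_subgroup_incl generate_is_subgroup[OF sub] by blast
  then show ?thesis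
    using L' sub generate_incl[OF sub] s by (auto simp: marking_def)
qed

text \<open>Frees \<open>preforms\<close> from its existential choice of generators of
  \<open>H\<close>. Words \<open>v\<close> express \<open>t'\<close> through \<open>t\<close>, words
  \<open>u\<close> express \<open>t\<close> through \<open>t'\<close>. Evaluating \<open>v\<close>
  at a marking \<open>s\<close> of \<open>G\<close> gives \<open>s'\<close>. The finitely many
  equations expressing \<open>t\<close> through \<open>t'\<close> are short relations, so they carry
  over to \<open>G\<close>, and \<open>s'\<close> generates.\<close>

lemma approximates_change_marking:
  assumes G: "group G" and H: "group H" and t: "marking H L t" and t': "marking H L' t'"
    and "approximates G H L t"
  shows "approximates G H L' t'"
  unfolding approximates_def
proof
  fix R
  interpret G: group G by fact
  interpret H: group H by fact
  have tL: "t ` L \<subseteq> carrier H" "finite L" and t'L: "t' ` L' \<subseteq> carrier H" "finite L'" "inj_on t' L'"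
    using t t' by (auto simp: marking_def)
  have "t' ` L' \<subseteq> eval_word H t ` lists (L \<times> UNIV)" "t ` L \<subseteq> eval_word H t' ` lists (L' \<times> UNIV)"
    using t t' H.generate_eq_eval_word[OF tL(1)] H.generate_eq_eval_word[OF t'L(1)]
    by (auto simp: marking_def)
  then have "\<forall>l\<in>L'. \<exists>w. w \<in> lists (L \<times> UNIV) \<and> eval_word H t w = t' l"
    and "\<forall>l\<in>L. \<exists>w. w \<in> lists (L' \<times> UNIV) \<and> eval_word H t' w = t l"
    by (simp_all add: image_subset_iff image_iff) metis+
  then obtain v u
    where v: "\<And>l. l \<in> L' \<Longrightarrow> v l \<in> lists (L \<times> UNIV)" "\<And>l. l \<in> L' \<Longrightarrow> eval_word H t (v l) = t' l"
      and u: "\<And>l. l \<in> L \<Longrightarrow> u l \<in> lists (L' \<times> UNIV)" "\<And>l. l \<in> L \<Longrightarrow> eval_word H t' (u l) = t l"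
    by metis
  \<comment> \<open>\<open>M\<close> and \<open>N\<close> bound the lengths of the words
    \<open>v\<close> and \<open>u\<close>. Both are positive, so one-letter words are short enough,
    and \<open>N\<close> exceeds \<open>R\<close>. Substituting \<open>v\<close> turns length
    \<open>N\<close> into at most \<open>M * N\<close>.\<close>
  define M where "M = Suc (Max ({0} \<union> (length \<circ> v) ` L'))"
  define N where "N = Suc (R + Max ({0} \<union> (length \<circ> u) ` L))"
  have M: "length (v l) \<le> M" if "l \<in> L'" for l
  proof -
    have "length (v l) \<le> Max ({0} \<union> (length \<circ> v) ` L')" using t'L(2) that by (intro Max_ge) auto
    then show ?thesis by (simp add: M_def)
  qed
  have N: "length (u l) \<le> N" if "l \<in> L" for l
  proof -
    have "length (u l) \<le> Max ({0} \<union> (length \<circ> u) ` L)" using tL(2) that by (intro Max_ge) auto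
    then show ?thesis by (simp add: N_def)
  qed
  have subst: "substitute_word v w \<in> short_words L (M * N)"
    if "w \<in> lists (L' \<times> UNIV)" "length w \<le> N" for w
  proof -
    have "length (substitute_word v w) \<le> M * length w"
      using M that(1) by (rule length_substitute_word)
    also have "\<dots> \<le> M * N" using that(2) by simp
    finally show ?thesis using lists_substitute_word[OF v(1) that(1)] by (simp add: short_words_def)
  qed
  obtain s where s: "marking G L s" "relations_upto G s L (M * N) = relations_upto H t L (M * N)"
    using assms(5) unfolding approximates_def by blast
  have sL: "s ` L \<subseteq> carrier G" using s(1) by (simp add: marking_def)
  define s' where "s' l = eval_word G s (v l)" for l
  have ev_s': "eval_word G s' w = eval_word G s (substitute_word v w)"
    if "w \<in> lists (L' \<times> UNIV)" for w
    unfolding s'_def using G.eval_substitute_word[OF sL v(1) that] by simp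
  have ev_t': "eval_word H t' w = eval_word H t (substitute_word v w)"
    if "w \<in> lists (L' \<times> UNIV)" for w
  proof -
    have "eval_word H t' w = eval_word H (\<lambda>l. eval_word H t (v l)) w"
      using that by (induction w) (auto simp: v(2))
    then show ?thesis using H.eval_substitute_word[OF tL(1) v(1) that] by simp
  qed
  have same: "eval_word G s w = eval_word G s w' \<longleftrightarrow> eval_word H t w = eval_word H t w'"
    if "w \<in> short_words L (M * N)" "w' \<in> short_words L (M * N)" for w w'
    using relations_upto_eqD[OF s(2) that] .
  have rel: "relations_upto G s' L' N = relations_upto H t' L' N"
  proof (rule relations_upto_eqI)
    fix w w' assume "w \<in> short_words L' N" "w' \<in> short_words L' N"
    then have w: "w \<in> lists (L' \<times> UNIV)" "length w \<le> N" "w' \<in> lists (L' \<times> UNIV)" "length w' \<le> N"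
      by (auto simp: short_words_def)
    show "eval_word G s' w = eval_word G s' w' \<longleftrightarrow> eval_word H t' w = eval_word H t' w'"
      unfolding ev_s'[OF w(1)] ev_s'[OF w(3)] ev_t'[OF w(1)] ev_t'[OF w(3)]
      by (rule same) (use subst w in blast)+
  qed
  have s'c: "s' l \<in> carrier G" if "l \<in> L'" for l
    unfolding s'_def by (rule G.eval_word_closed[OF sL v(1)[OF that]])
  have inj: "inj_on s' L'"
  proof (rule inj_onI)
    fix l m assume l: "l \<in> L'" "m \<in> L'" and eq: "s' l = s' m"
    have "[(l, True)] \<in> short_words L' N" "[(m, True)] \<in> short_words L' N"
      using l by (auto simp: short_words_def N_def)
    from relations_upto_eqD[OF rel this] have "t' l = t' m"
      using eq s'c l t'L(1) by (simp add: image_subset_iff)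
    then show "l = m" using t'L(3) l by (simp add: inj_on_def)
  qed
  have "marking G L' s'"
  proof (rule marking_if_relations[OF G s(1) t'L(2) inj s'c])
    fix l assume l: "l \<in> L"
    have "M * N \<ge> 1" by (simp add: M_def N_def)
    then have "[(l, True)] \<in> short_words L (M * N)" using l by (simp add: short_words_def)
    note same[OF subst[OF u(1)[OF l] N[OF l]] this]
    moreover have c: "s l \<in> carrier G" "t l \<in> carrier H" using l sL tL(1) by auto
    moreover have "eval_word H t (substitute_word v (u l)) = t l"
      using ev_t'[OF u(1)[OF l]] u(2)[OF l] by simp
    ultimately
    have "eval_word G s (substitute_word v (u l)) = s l"
      by simp
    then show "u l \<in> lists (L' \<times> UNIV) \<and> eval_word G s' (u l) = s l"
      using ev_s'[OF u(1)[OF l]] u(1)[OF l] by simp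
  qed
  moreover have "relations_upto G s' L' R = relations_upto H t' L' R"
    by (rule relations_upto_antimono[OF rel]) (simp add: N_def)
  ultimately show "\<exists>s. marking G L' s \<and> relations_upto G s L' R = relations_upto H t' L' R"
    by blast
qed

lemma preforms_iff_approximates:
  assumes "group G" "group H" "marking H L t"
  shows "preforms G H \<longleftrightarrow> approximates G H L t"
proof
  assume "preforms G H"
  then obtain T where "finite_generating_set H T" "approximates G H T id"
    using preforms_imp_approximates assms by blast
  then show "approximates G H L t"
    using approximates_change_marking[OF assms(1,2) marking_id assms(3)] by blast
qed (rule approximates_imp_preforms[OF assms])

section \<open>The set of finite patterns of a group\<close>

type_synonym pattern = "nat \<times> nat \<times> ((nat \<times> bool) list \<times> (nat \<times> bool) list) set"

text \<open>The labels are the numbers below \<open>k\<close>, so that the patterns of all groups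
  lie in one countable set.\<close>

definition patterns :: "('a, 'c) monoid_scheme \<Rightarrow> pattern set" where
  "patterns G = {(k, R, relations_upto G s {..<k} R) | k R s. marking G {..<k} s}"

lemma countable_patterns: "countable (UNIV \<times> UNIV \<times> Collect finite :: pattern set)"
  by (intro countable_SIGMA countable_Collect_finite) auto

lemma patterns_subset: "patterns G \<subseteq> UNIV \<times> UNIV \<times> Collect finite"
proof -
  have "finite (relations_upto G s {..<k} R)" for s :: "nat \<Rightarrow> 'a" and k R
    unfolding relations_upto_def
    by (rule finite_subset[of _ "short_words {..<k} R \<times> short_words {..<k} R"])
      (auto simp: finite_short_words)
  then show ?thesis by (auto simp: patterns_def)
qed

text \<open>\<open>approximates\<close> does not depend on the marking, so \<open>G\<close> must
  realise the pattern of every marking of \<open>H\<close>. Conversely the patterns of a single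
  marking of \<open>H\<close>, at all radii, make \<open>G\<close> approximate
  \<open>H\<close>.\<close>

lemma preforms_iff_patterns:
  assumes G: "group G" and H: "finitely_generated_group H"
  shows "preforms G H \<longleftrightarrow> patterns H \<subseteq> patterns G"
proof
  have gH: "group H" using H by (simp add: finitely_generated_group_def)
  show "patterns H \<subseteq> patterns G" if pre: "preforms G H"
  proof
    fix x assume "x \<in> patterns H"
    then obtain k R t where x: "x = (k, R, relations_upto H t {..<k} R)" and t: "marking H {..<k} t"
      by (auto simp: patterns_def)
    then obtain s where "marking G {..<k} s" "relations_upto G s {..<k} R = relations_upto H t {..<k} R"
      using pre preforms_iff_approximates[OF G gH t] unfolding approximates_def by blast
    then show "x \<in> patterns G" unfolding x patterns_def by force
  qed
  obtain T where T: "finite_generating_set H T" using H by (auto simp: finitely_generated_group_def)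
  then obtain t where "bij_betw t {0..<card T} T"
    using ex_bij_betw_nat_finite[of T] by (auto simp: finite_generating_set_def)
  then have t: "marking H {..<card T} t"
    using T by (auto simp: marking_def finite_generating_set_def bij_betw_def lessThan_atLeast0)
  assume sub: "patterns H \<subseteq> patterns G"
  have "\<exists>s. marking G {..<card T} s \<and>
      relations_upto G s {..<card T} R = relations_upto H t {..<card T} R" for R
  proof -
    have "(card T, R, relations_upto H t {..<card T} R) \<in> patterns H"
      using t unfolding patterns_def by blast
    then have "(card T, R, relations_upto H t {..<card T} R) \<in> patterns G" using sub by blast
    then show ?thesis unfolding patterns_def by auto
  qed
  then show "preforms G H"
    using approximates_imp_preforms[OF G gH t] unfolding approximates_def by blast
qed

section \<open>Hall's group over the Laurent polynomials and its central quotients\<close>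

type_synonym laurent = "int \<Rightarrow>\<^sub>0 int"

lemma frag_of_add: "frag_of (m + n :: int) = frag_of m * frag_of n"
  by (simp add: mult_single)

lemma frag_of_inverse [simp]:
  "frag_of (- n :: int) * (frag_of n * x) = x" "frag_of n * (frag_of (- n :: int) * x) = x"
  by (simp_all add: mult_single flip: mult.assoc)

lemma lookup_frag_of_mult:
  "Poly_Mapping.lookup (frag_of m * z) k = Poly_Mapping.lookup z (k - m)" for z :: laurent
proof -
  have "Poly_Mapping.keys z \<subseteq> UNIV" by simp
  then show ?thesis
  proof (induction z rule: frag_induction)
    case (one i)
    then show ?case by (auto simp: mult_single)
  qed (simp_all add: right_diff_distrib lookup_minus)
qed

text \<open>
  \<open>(x, n, y, z)\<close> stands for the matrix with rows \<open>(1, x, z)\<close>, \<open>(0, t\<^sup>n, y)\<close>, \<open>(0, 0, 1)\<close> over the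
  Laurent polynomials in \<open>t\<close>; the monomial \<open>t\<^sup>n\<close> is \<open>frag_of n\<close>.
\<close>

definition hall_group :: "(laurent \<times> int \<times> laurent \<times> laurent) monoid" where
  "hall_group = \<lparr>carrier = UNIV,
     monoid.mult = (\<lambda>(x, n, y, z) (x', n', y', z').
       (x' + x * frag_of n', n + n', y + frag_of n * y', z + z' + x * y')),
     one = (0, 0, 0, 0)\<rparr>"

lemma carrier_hall_group [simp]: "carrier hall_group = UNIV"
  by (simp add: hall_group_def)

lemma one_hall_group [simp]: "\<one>\<^bsub>hall_group\<^esub> = (0, 0, 0, 0)"
  by (simp add: hall_group_def)

lemma mult_hall_group [simp]:
  "(x, n, y, z) \<otimes>\<^bsub>hall_group\<^esub> (x', n', y', z') =
     (x' + x * frag_of n', n + n', y + frag_of n * y', z + z' + x * y')"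
  by (simp add: hall_group_def)

lemma group_hall_group: "group hall_group"
proof (rule groupI)
  fix a b c :: "laurent \<times> int \<times> laurent \<times> laurent"
  obtain x n y z where a: "a = (x, n, y, z)" by (metis surj_pair)
  obtain x' n' y' z' where b: "b = (x', n', y', z')" by (metis surj_pair)
  obtain x'' n'' y'' z'' where c: "c = (x'', n'', y'', z'')" by (metis surj_pair)
  show "a \<otimes>\<^bsub>hall_group\<^esub> b \<otimes>\<^bsub>hall_group\<^esub> c = a \<otimes>\<^bsub>hall_group\<^esub> (b \<otimes>\<^bsub>hall_group\<^esub> c)"
    by (simp add: a b c frag_of_add algebra_simps)
  show "\<one>\<^bsub>hall_group\<^esub> \<otimes>\<^bsub>hall_group\<^esub> a = a" by (simp add: a)
  \<comment> \<open>These are the entries of the inverse matrix.\<close>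
  have "(- (x * frag_of (- n)), - n, - (frag_of (- n) * y), x * frag_of (- n) * y - z)
      \<otimes>\<^bsub>hall_group\<^esub> a = \<one>\<^bsub>hall_group\<^esub>"
    by (simp add: a mult_single mult.assoc)
  then show "\<exists>b\<in>carrier hall_group. b \<otimes>\<^bsub>hall_group\<^esub> a = \<one>\<^bsub>hall_group\<^esub>" by auto
qed auto

interpretation hall: group hall_group
  by (rule group_hall_group)

text \<open>The elementary matrices with \<open>x = 1\<close> and with \<open>y = 1\<close>, and
  \<open>diag(1, t, 1)\<close>.\<close>

definition hall_gen :: "nat \<Rightarrow> laurent \<times> int \<times> laurent \<times> laurent" where
  "hall_gen l = (if l = 0 then (1, 0, 0, 0) else if l = 1 then (0, 0, 1, 0) else (0, 1, 0, 0))"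

text \<open>Powers of the diagonal generator conjugate the other two to every \<open>t^i\<close> in
  the entries \<open>x\<close> and \<open>y\<close>; differences of these give all \<open>x\<close>
  and \<open>y\<close>, and commutators give the centre.\<close>

lemma hall_group_generated: "generate hall_group (hall_gen ` {..<3}) = UNIV"
proof -
  define E where "E = generate hall_group (hall_gen ` {..<3})"
  have mult: "a \<otimes>\<^bsub>hall_group\<^esub> b \<in> E" if "a \<in> E" "b \<in> E" for a b
    using that generate.eng unfolding E_def by metis
  have inverse: "b \<in> E" if "a \<in> E" "b \<otimes>\<^bsub>hall_group\<^esub> a = (0, 0, 0, 0)" for a b
  proof -
    have "b = inv\<^bsub>hall_group\<^esub> a" using hall.inv_equality[of b a] that(2) by simp
    then show ?thesis using hall.generate_m_inv_closed[of _ a] that(1) by (simp add: E_def)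
  qed
  have gens: "(1, 0, 0, 0) \<in> E" "(0, 0, 1, 0) \<in> E" "(0, 1, 0, 0) \<in> E"
  proof -
    have "hall_gen l \<in> E" if "l < 3" for l
      unfolding E_def by (rule generate.incl) (use that in auto)
    from this[of 0] this[of 1] this[of 2]
    show "(1, 0, 0, 0) \<in> E" "(0, 0, 1, 0) \<in> E" "(0, 1, 0, 0) \<in> E"
      by (simp_all add: hall_gen_def)
  qed
  have t_nat: "(0, int n, 0, 0) \<in> E" for n
  proof (induction n)
    case 0
    have "\<one>\<^bsub>hall_group\<^esub> \<in> E" unfolding E_def by (rule generate.one)
    then show ?case by simp
  next
    case (Suc n)
    then show ?case using mult[OF Suc gens(3)] by (simp add: add.commute)
  qed
  have t: "(0, n, 0, 0) \<in> E" for n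
  proof (cases "n \<ge> 0")
    case True
    then show ?thesis using t_nat[of "nat n"] by simp
  next
    case False
    then show ?thesis using inverse[OF t_nat[of "nat (- n)"], of "(0, n, 0, 0)"] by simp
  qed
  have x: "(x, 0, 0, 0) \<in> E" for x
  proof -
    have "Poly_Mapping.keys x \<subseteq> UNIV" by simp
    then show ?thesis
    proof (induction x rule: frag_induction)
      case zero
      show ?case using t[of 0] .
    next
      case (one i)
      show ?case using mult[OF mult[OF t[of "- i"] gens(1)] t[of i]] by simp
    next
      case (diff a b)
      have "(- b, 0, 0, 0) \<in> E" using inverse[OF diff(2), of "(- b, 0, 0, 0)"] by simp
      then show ?case using mult[OF diff(1)] by fastforce
    qed
  qed
  have y: "(0, 0, y, 0) \<in> E" for y
  proof -
    have "Poly_Mapping.keys y \<subseteq> UNIV" by simp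
    then show ?thesis
    proof (induction y rule: frag_induction)
      case zero
      show ?case using t[of 0] .
    next
      case (one i)
      show ?case using mult[OF mult[OF t[of i] gens(2)] t[of "- i"]] by simp
    next
      case (diff a b)
      have "(0, 0, - b, 0) \<in> E" using inverse[OF diff(2), of "(0, 0, - b, 0)"] by simp
      then show ?case using mult[OF diff(1)] by fastforce
    qed
  qed
  have z: "(0, 0, 0, z) \<in> E" for z
  proof -
    \<comment> \<open>The commutator of \<open>(0, 0, z, 0)\<close> with
      \<open>(- 1, 0, 0, 0)\<close>.\<close>
    from mult[OF mult[OF y[of z] x[of "- 1"]] mult[OF y[of "- z"] x[of 1]]] show ?thesis by simp
  qed
  have "(x, n, y, z) \<in> E" for x n y z
    using mult[OF mult[OF mult[OF y[of y] t[of n]] x[of x]] z[of z]] by simp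
  then show ?thesis unfolding E_def by auto
qed

section \<open>Shifts and the central quotients\<close>

definition hall_shift ::
    "int \<Rightarrow> laurent \<times> int \<times> laurent \<times> laurent \<Rightarrow> laurent \<times> int \<times> laurent \<times> laurent" where
  "hall_shift m = (\<lambda>(x, n, y, z). (x, n, frag_of m * y, frag_of m * z))"

lemma hall_shift_simp [simp]:
  "hall_shift m (x, n, y, z) = (x, n, frag_of m * y, frag_of m * z)"
  by (simp add: hall_shift_def)

text \<open>The shift is \<open>a \<mapsto> d a d^-1\<close> for the matrix
  \<open>d = diag(1, 1, t^-m)\<close>.\<close>

lemma hall_shift_hom: "hall_shift m \<in> hom hall_group hall_group"
  by (auto simp: hom_def algebra_simps)

lemma surj_hall_shift: "surj (hall_shift m)"
proof (rule surjI)
  show "hall_shift m (hall_shift (- m) a) = a" for a by (cases a) simp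
qed

text \<open>
  The coefficients of the central entry \<open>z\<close> are reduced modulo the colours: the colour 0 leaves a
  coefficient free, the colour 1 kills it.
\<close>

definition colour_kernel :: "(int \<Rightarrow> nat) \<Rightarrow> (laurent \<times> int \<times> laurent \<times> laurent) set" where
  "colour_kernel c = {(0, 0, 0, z) | z. \<forall>k. int (c k) dvd Poly_Mapping.lookup z k}"

definition hall_quotient :: "(int \<Rightarrow> nat) \<Rightarrow> (laurent \<times> int \<times> laurent \<times> laurent) set monoid" where
  "hall_quotient c = hall_group Mod colour_kernel c"

definition hall_class ::
    "(int \<Rightarrow> nat) \<Rightarrow> laurent \<times> int \<times> laurent \<times> laurent \<Rightarrow> (laurent \<times> int \<times> laurent \<times> laurent) set" where
  "hall_class c a = colour_kernel c #>\<^bsub>hall_group\<^esub> a"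

lemma hall_class_eq_iff:
  "hall_class c (x, n, y, z) = hall_class c (x', n', y', z') \<longleftrightarrow> x = x' \<and> n = n' \<and> y = y' \<and>
     (\<forall>k. int (c k) dvd Poly_Mapping.lookup z k - Poly_Mapping.lookup z' k)"
proof -
  have "hall_class c (x, n, y, z) =
      {(x, n, y, z') | z'. \<forall>k. int (c k) dvd Poly_Mapping.lookup z' k - Poly_Mapping.lookup z k}"
    for x n y z
  proof (intro equalityI subsetI)
    fix a assume "a \<in> hall_class c (x, n, y, z)"
    then show "a \<in> {(x, n, y, z') | z'. \<forall>k. int (c k) dvd Poly_Mapping.lookup z' k - Poly_Mapping.lookup z k}"
      by (auto simp: hall_class_def colour_kernel_def r_coset_def lookup_add)
  next
    fix a assume "a \<in> {(x, n, y, z') | z'. \<forall>k. int (c k) dvd Poly_Mapping.lookup z' k - Poly_Mapping.lookup z k}"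
    then obtain z' where a: "a = (x, n, y, z')"
        and "\<forall>k. int (c k) dvd Poly_Mapping.lookup z' k - Poly_Mapping.lookup z k" by blast
    then have "(0, 0, 0, z' - z) \<in> colour_kernel c" by (simp add: colour_kernel_def lookup_minus)
    moreover have "a = (0, 0, 0, z' - z) \<otimes>\<^bsub>hall_group\<^esub> (x, n, y, z)" by (simp add: a)
    ultimately show "a \<in> hall_class c (x, n, y, z)"
      unfolding hall_class_def r_coset_def by blast
  qed
  note eq = this
  show ?thesis
  proof
    assume "hall_class c (x, n, y, z) = hall_class c (x', n', y', z')"
    moreover have "(x, n, y, z) \<in> hall_class c (x, n, y, z)" unfolding eq by simp
    ultimately have "(x, n, y, z) \<in> hall_class c (x', n', y', z')" by simp
    then show "x = x' \<and> n = n' \<and> y = y' \<and>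
        (\<forall>k. int (c k) dvd Poly_Mapping.lookup z k - Poly_Mapping.lookup z' k)"
      unfolding eq by simp
  next
    assume r: "x = x' \<and> n = n' \<and> y = y' \<and>
        (\<forall>k. int (c k) dvd Poly_Mapping.lookup z k - Poly_Mapping.lookup z' k)"
    have "int (c k) dvd a - Poly_Mapping.lookup z k \<longleftrightarrow> int (c k) dvd a - Poly_Mapping.lookup z' k" for a k
    proof -
      have "a - Poly_Mapping.lookup z' k =
          (a - Poly_Mapping.lookup z k) + (Poly_Mapping.lookup z k - Poly_Mapping.lookup z' k)" by simp
      then show ?thesis using r by (metis dvd_add_left_iff)
    qed
    then show "hall_class c (x, n, y, z) = hall_class c (x', n', y', z')"
      unfolding eq using r by simp
  qed
qed

text \<open>\<open>(0, 0, 0, z)\<close> commutes with every element, so left and right cosets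
  agree.\<close>

lemma normal_colour_kernel: "colour_kernel c \<lhd> hall_group"
proof (rule hall.normalI)
  show "subgroup (colour_kernel c) hall_group"
  proof (rule hall.subgroupI)
    have "(0, 0, 0, 0) \<in> colour_kernel c" by (simp add: colour_kernel_def)
    then show "colour_kernel c \<noteq> {}" by blast
  next
    fix a assume "a \<in> colour_kernel c"
    then obtain z where a: "a = (0, 0, 0, z)" and z: "\<forall>k. int (c k) dvd Poly_Mapping.lookup z k"
      by (auto simp: colour_kernel_def)
    have "inv\<^bsub>hall_group\<^esub> a = (0, 0, 0, - z)"
      by (rule hall.inv_equality) (simp_all add: a)
    then show "inv\<^bsub>hall_group\<^esub> a \<in> colour_kernel c" using z by (simp add: colour_kernel_def)
  qed (auto simp: colour_kernel_def lookup_add)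
  show "\<forall>a\<in>carrier hall_group. colour_kernel c #>\<^bsub>hall_group\<^esub> a = a <#\<^bsub>hall_group\<^esub> colour_kernel c"
    by (auto simp: r_coset_def l_coset_def colour_kernel_def add.commute)
qed

lemma group_hall_quotient: "group (hall_quotient c)"
  unfolding hall_quotient_def by (rule normal.factorgroup_is_group[OF normal_colour_kernel])

lemma hall_class_hom: "hall_class c \<in> hom hall_group (hall_quotient c)"
  using normal.r_coset_hom_Mod[OF normal_colour_kernel, of c]
  by (simp add: hall_class_def[abs_def] hall_quotient_def)

lemma carrier_hall_quotient: "carrier (hall_quotient c) = range (hall_class c)"
  by (simp add: hall_quotient_def hall_class_def carrier_FactGroup)

lemma group_hom_hall_class_shift:
  "group_hom hall_group (hall_quotient c) (hall_class c \<circ> hall_shift m)"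
  using hom_compose[OF hall_shift_hom hall_class_hom] group_hall_group group_hall_quotient
  by (simp add: group_hom_def group_hom_axioms_def)

lemma hall_class_one: "hall_class c (0, 0, 0, 0) = \<one>\<^bsub>hall_quotient c\<^esub>"
  using group_hom.hom_one[of hall_group "hall_quotient c" "hall_class c"] hall_class_hom
    group_hall_group group_hall_quotient by (simp add: group_hom_def group_hom_axioms_def)

text \<open>The coefficient of \<open>z\<close> at \<open>k\<close> sits at position
  \<open>k + m\<close> of \<open>frag_of m * z\<close>, so composing with the shift amounts to
  moving the colouring by \<open>m\<close>.\<close>

lemma hall_class_shift_eq_iff:
  "hall_class c (hall_shift m (x, n, y, z)) = hall_class c (hall_shift m (x', n', y', z')) \<longleftrightarrow>
    x = x' \<and> n = n' \<and> y = y' \<and>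
     (\<forall>k. int (c (k + m)) dvd Poly_Mapping.lookup z k - Poly_Mapping.lookup z' k)"
proof -
  have "frag_of m * y = frag_of m * y' \<longleftrightarrow> y = y'" by (metis frag_of_inverse(1))
  moreover have "(\<forall>k. int (c k) dvd Poly_Mapping.lookup z (k - m) - Poly_Mapping.lookup z' (k - m)) \<longleftrightarrow>
    (\<forall>k. int (c (k + m)) dvd Poly_Mapping.lookup z k - Poly_Mapping.lookup z' k)"
    by (metis add_diff_cancel diff_add_cancel)
  ultimately show ?thesis by (simp add: hall_class_eq_iff lookup_frag_of_mult)
qed

definition hall_marking ::
    "(int \<Rightarrow> nat) \<Rightarrow> int \<Rightarrow> nat \<Rightarrow> (laurent \<times> int \<times> laurent \<times> laurent) set" where
  "hall_marking c m = (hall_class c \<circ> hall_shift m) \<circ> hall_gen"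

text \<open>The shift is onto, so the shifted generators still generate. The quotient leaves
  \<open>x\<close>, \<open>n\<close> and \<open>y\<close> intact, and these tell the generators
  apart.\<close>

lemma marking_hall_marking: "marking (hall_quotient c) {..<3} (hall_marking c m)"
proof -
  interpret h: group_hom hall_group "hall_quotient c" "hall_class c \<circ> hall_shift m"
    by (rule group_hom_hall_class_shift)
  have "generate (hall_quotient c) (hall_marking c m ` {..<3}) =
      (hall_class c \<circ> hall_shift m) ` UNIV"
    using h.generate_img[of "hall_gen ` {..<3}"] hall_group_generated
    by (simp add: hall_marking_def image_image)
  also have "\<dots> = carrier (hall_quotient c)"
    using surj_hall_shift[of m] by (simp add: carrier_hall_quotient flip: image_image)
  moreover have "inj_on (hall_marking c m) {..<3}"
  proof (rule inj_onI)
    fix i j :: nat assume "i \<in> {..<3}" "j \<in> {..<3}" "hall_marking c m i = hall_marking c m j"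
    then show "i = j"
      by (auto simp: hall_marking_def hall_gen_def hall_class_shift_eq_iff
          simp del: hall_shift_simp split: if_splits)
  qed
  moreover have "hall_marking c m ` {..<3} \<subseteq> carrier (hall_quotient c)"
    by (auto simp: hall_marking_def carrier_hall_quotient)
  ultimately show ?thesis by (simp add: marking_def)
qed

lemma finitely_generated_hall_quotient: "finitely_generated_group (hall_quotient c)"
  using group_hall_quotient finite_generating_set_marking[OF marking_hall_marking]
  unfolding finitely_generated_group_def by blast

lemma eval_hall_marking:
  assumes "w \<in> lists ({..<3} \<times> UNIV)"
  shows "eval_word (hall_quotient c) (hall_marking c m) w =
    hall_class c (hall_shift m (eval_word hall_group hall_gen w))"
  using group_hom.hom_eval_word[OF group_hom_hall_class_shift _ assms, of hall_gen c m]
  by (simp add: hall_marking_def)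

text \<open>
  Shifting the second generator by \<open>t\<^sup>m\<close> shifts the colouring by \<open>m\<close>, while a ball involves only
  finitely many coefficients of the central entry.
\<close>

lemma preforms_hall_quotient:
  assumes "\<And>M :: int. \<exists>m. \<forall>k. \<bar>k\<bar> \<le> M \<longrightarrow> c (k + m) = c' k"
  shows "preforms (hall_quotient c) (hall_quotient c')"
proof (rule approximates_imp_preforms[OF group_hall_quotient group_hall_quotient marking_hall_marking])
  show "approximates (hall_quotient c) (hall_quotient c') {..<3} (hall_marking c' 0)"
    unfolding approximates_def
  proof
    fix R
    let ?W = "short_words {..<3::nat} R"
    \<comment> \<open>\<open>K\<close> is the finite set of exponents in the central entries of
      short words; outside it all coefficients vanish and the colours impose no condition. The
      \<open>0\<close> in \<open>M\<close> covers empty \<open>K\<close>.\<close>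
    define zz where "zz w = snd (snd (snd (eval_word hall_group hall_gen w)))" for w
    define K where "K = (\<Union>w\<in>?W. Poly_Mapping.keys (zz w))"
    have "finite K" unfolding K_def by (intro finite_UN_I finite_short_words) simp_all
    define M where "M = Max ({0} \<union> abs ` K)"
    have M: "\<bar>k\<bar> \<le> M" if "k \<in> K" for k
      unfolding M_def using \<open>finite K\<close> that by (intro Max_ge) auto
    obtain m where m: "\<And>k. \<bar>k\<bar> \<le> M \<Longrightarrow> c (k + m) = c' k" using assms by blast
    have "relations_upto (hall_quotient c) (hall_marking c m) {..<3} R =
        relations_upto (hall_quotient c') (hall_marking c' 0) {..<3} R"
    proof (rule relations_upto_eqI)
      fix w w' assume w: "w \<in> ?W" "w' \<in> ?W"
      obtain x n y z where e: "eval_word hall_group hall_gen w = (x, n, y, z)" by (metis surj_pair)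
      obtain x' n' y' z' where e': "eval_word hall_group hall_gen w' = (x', n', y', z')"
        by (metis surj_pair)
      have keys: "Poly_Mapping.keys z \<subseteq> K" "Poly_Mapping.keys z' \<subseteq> K"
        using w e e' by (force simp: K_def zz_def)+
      have "int (c (k + m)) dvd Poly_Mapping.lookup z k - Poly_Mapping.lookup z' k \<longleftrightarrow>
          int (c' k) dvd Poly_Mapping.lookup z k - Poly_Mapping.lookup z' k" for k
      proof (cases "k \<in> K")
        case True
        then show ?thesis using M m by simp
      next
        case False
        then have "Poly_Mapping.lookup z k = 0" "Poly_Mapping.lookup z' k = 0"
          using keys by (auto simp: in_keys_iff)
        then show ?thesis by simp
      qed
      then have "hall_class c (hall_shift m (x, n, y, z)) = hall_class c (hall_shift m (x', n', y', z')) \<longleftrightarrow>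
          hall_class c' (hall_shift 0 (x, n, y, z)) = hall_class c' (hall_shift 0 (x', n', y', z'))"
        unfolding hall_class_shift_eq_iff by simp
      moreover have "w \<in> lists ({..<3} \<times> UNIV)" "w' \<in> lists ({..<3} \<times> UNIV)"
        using w by (simp_all add: short_words_def)
      ultimately show "eval_word (hall_quotient c) (hall_marking c m) w =
            eval_word (hall_quotient c) (hall_marking c m) w' \<longleftrightarrow>
          eval_word (hall_quotient c') (hall_marking c' 0) w =
            eval_word (hall_quotient c') (hall_marking c' 0) w'"
        by (simp only: eval_hall_marking e e')
    qed
    then show "\<exists>s. marking (hall_quotient c) {..<3} s \<and>
        relations_upto (hall_quotient c) s {..<3} R =
        relations_upto (hall_quotient c') (hall_marking c' 0) {..<3} R"
      using marking_hall_marking by blast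
  qed
qed

section \<open>Torsion in the central quotients\<close>

lemma hall_pow_first: "\<exists>x' y' z'. (x, n, y, z) [^]\<^bsub>hall_group\<^esub> (q::nat) = (x', int q * n, y', z')"
proof (induction q)
  case (Suc q)
  then obtain x' y' z' where "(x, n, y, z) [^]\<^bsub>hall_group\<^esub> q = (x', int q * n, y', z')" by blast
  then show ?case by (simp add: algebra_simps)
qed simp

lemma hall_pow_unipotent:
  "\<exists>z'. (x, 0, y, z) [^]\<^bsub>hall_group\<^esub> (q::nat) = (frag_cmul (int q) x, 0, frag_cmul (int q) y, z')"
proof (induction q)
  case (Suc q)
  then obtain z' where
    "(x, 0, y, z) [^]\<^bsub>hall_group\<^esub> q = (frag_cmul (int q) x, 0, frag_cmul (int q) y, z')" by blast
  then show ?case by (simp add: frag_cmul_distrib add.commute)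
qed simp

lemma hall_pow_central:
  "(0, 0, 0, z) [^]\<^bsub>hall_group\<^esub> (q::nat) = (0, 0, 0, frag_cmul (int q) z)"
  by (induction q) (simp_all add: frag_cmul_distrib add.commute)

lemma hall_class_pow:
  "hall_class c a [^]\<^bsub>hall_quotient c\<^esub> (q::nat) = hall_class c (a [^]\<^bsub>hall_group\<^esub> q)"
  using hom_nat_pow[OF hall_class_hom _ group_hall_group group_hall_quotient, of a c q] by simp

definition has_torsion :: "('a, 'c) monoid_scheme \<Rightarrow> nat \<Rightarrow> bool" where
  "has_torsion G p \<longleftrightarrow> (\<exists>g\<in>carrier G. g [^]\<^bsub>G\<^esub> p = \<one>\<^bsub>G\<^esub> \<and> g \<noteq> \<one>\<^bsub>G\<^esub>)"

text \<open>Taking powers is additive in \<open>n\<close>, and once \<open>n = 0\<close> also in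
  \<open>x\<close> and \<open>y\<close>, so a torsion element comes from some
  \<open>(0, 0, 0, z)\<close>. Where a coefficient of \<open>z\<close> is not divisible by its
  colour but \<open>p\<close> times it is, the colour cannot be 0, 1 or a prime other than
  \<open>p\<close>.\<close>

lemma has_torsion_hall_quotient_iff:
  assumes c: "\<And>k. c k = 0 \<or> c k = 1 \<or> prime (c k)" and p: "prime p"
  shows "has_torsion (hall_quotient c) p \<longleftrightarrow> p \<in> range c"
proof
  assume "p \<in> range c"
  then obtain k where k: "c k = p" by blast
  let ?a = "(0, 0, 0, frag_of k) :: laurent \<times> int \<times> laurent \<times> laurent"
  have "hall_class c (?a [^]\<^bsub>hall_group\<^esub> p) = hall_class c (0, 0, 0, 0)"
    unfolding hall_pow_central hall_class_eq_iff using k by simp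
  moreover have "hall_class c ?a \<noteq> hall_class c (0, 0, 0, 0)"
  proof
    assume "hall_class c ?a = hall_class c (0, 0, 0, 0)"
    then have "int (c k) dvd 1" unfolding hall_class_eq_iff by (auto dest: spec[of _ k])
    then show False using k p by (simp add: not_prime_1)
  qed
  ultimately show "has_torsion (hall_quotient c) p"
    unfolding has_torsion_def carrier_hall_quotient
    by (intro bexI[of _ "hall_class c ?a"]) (simp_all only: hall_class_pow hall_class_one, simp_all)
next
  assume "has_torsion (hall_quotient c) p"
  then obtain g where g: "g \<in> range (hall_class c)" "g [^]\<^bsub>hall_quotient c\<^esub> p = \<one>\<^bsub>hall_quotient c\<^esub>"
      "g \<noteq> \<one>\<^bsub>hall_quotient c\<^esub>"
    unfolding has_torsion_def carrier_hall_quotient by blast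
  then obtain a where "g = hall_class c a" by blast
  then have a: "hall_class c (a [^]\<^bsub>hall_group\<^esub> p) = hall_class c (0, 0, 0, 0)"
      "hall_class c a \<noteq> hall_class c (0, 0, 0, 0)"
    using g(2,3) unfolding hall_class_one by (simp_all only: hall_class_pow not_False_eq_True)
  obtain x n y z where xnyz: "a = (x, n, y, z)" by (metis surj_pair)
  have p0: "p > 0" using p by (rule prime_gt_0_nat)
  have n: "n = 0"
    using hall_pow_first[of x n y z p] a(1) p0 unfolding xnyz by (auto simp: hall_class_eq_iff)
  then have xy: "x = 0" "y = 0"
    using hall_pow_unipotent[of x y z p] a(1) p0 unfolding xnyz by (auto simp: hall_class_eq_iff)
  have "\<forall>k. int (c k) dvd int p * Poly_Mapping.lookup z k"
    using a(1) unfolding xnyz n xy hall_pow_central hall_class_eq_iff by simp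
  moreover obtain k where k: "\<not> int (c k) dvd Poly_Mapping.lookup z k"
    using a(2) unfolding xnyz n xy hall_class_eq_iff by auto
  ultimately have dvd: "int (c k) dvd int p * Poly_Mapping.lookup z k" by blast
  consider "c k = 0" | "c k = 1" | "prime (c k)" using c[of k] by metis
  then have "c k = p"
  proof cases
    case 3
    show ?thesis
    proof (rule ccontr)
      assume "c k \<noteq> p"
      then have "coprime (c k) p" using 3 p by (simp add: primes_coprime)
      then have "coprime (int (c k)) (int p)" by simp
      then show False using dvd k by (simp add: coprime_dvd_mult_right_iff)
    qed
  qed (use dvd k p0 in auto)
  then show "p \<in> range c" by blast
qed

lemma (in group) eval_word_power:
  assumes "s l \<in> carrier G"
  shows "eval_word G s (replicate n (l, True)) = s l [^] n"
proof (induction n)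
  case (Suc n)
  then show ?case using nat_pow_Suc2[OF assms, of n] by simp
qed simp

text \<open>Once \<open>h\<close> is adjoined to the generators, \<open>h^p = 1\<close> and
  \<open>h \<noteq> 1\<close> are visible in words of length at most \<open>Suc p\<close>, and a
  marking of \<open>G\<close> with the same short relations supplies an element with both
  properties.\<close>

lemma preforms_has_torsion:
  assumes G: "group G" and H: "group H" and "preforms G H" and "has_torsion H p"
  shows "has_torsion G p"
proof -
  interpret G: group G by fact
  interpret H: group H by fact
  obtain h where h: "h \<in> carrier H" "h [^]\<^bsub>H\<^esub> p = \<one>\<^bsub>H\<^esub>" "h \<noteq> \<one>\<^bsub>H\<^esub>"
    using assms(4) by (auto simp: has_torsion_def)
  obtain T where "finite_generating_set H T"
    using assms(3) by (auto simp: preforms_def)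
  then have fin: "finite_generating_set H (insert h T)"
    using h(1) H.mono_generate[of T "insert h T"] H.generate_incl[of "insert h T"]
    by (auto simp: finite_generating_set_def)
  have "approximates G H (insert h T) id"
    using assms(3) preforms_iff_approximates[OF G H marking_id[OF fin]] by blast
  then obtain s where s: "marking G (insert h T) s"
      "relations_upto G s (insert h T) (Suc p) = relations_upto H id (insert h T) (Suc p)"
    unfolding approximates_def by blast
  have sh: "s h \<in> carrier G" using s(1) by (simp add: marking_def)
  have words: "[] \<in> short_words (insert h T) (Suc p)" "[(h, True)] \<in> short_words (insert h T) (Suc p)"
    "replicate p (h, True) \<in> short_words (insert h T) (Suc p)"
    by (auto simp: short_words_def)
  have "s h [^]\<^bsub>G\<^esub> p = \<one>\<^bsub>G\<^esub>"
    using relations_upto_eqD[OF s(2) words(3,1)] h sh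
    by (simp add: G.eval_word_power H.eval_word_power)
  moreover have "s h \<noteq> \<one>\<^bsub>G\<^esub>"
    using relations_upto_eqD[OF s(2) words(2,1)] h sh by simp
  ultimately show ?thesis using sh by (auto simp: has_torsion_def)
qed

section \<open>Universal colourings\<close>

lemma universal_sequence:
  fixes D :: "'d set"
  assumes "countable D" "D \<noteq> {}"
  shows "\<exists>u :: nat \<Rightarrow> 'd. range u \<subseteq> D \<and> (\<forall>ws\<in>lists D. \<exists>p. \<forall>i<length ws. u (p + i) = ws ! i)"
proof -
  obtain d where d: "d \<in> D" using assms(2) by blast
  define e where "e = from_nat_into (lists D)"
  have cl: "countable (lists D)" and ne: "lists D \<noteq> {}" using countable_lists[OF assms(1)] by auto
  have e: "e n \<in> lists D" for n unfolding e_def by (rule from_nat_into[OF ne])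
  \<comment> \<open>\<open>prod_decode\<close> runs through consecutive blocks, block \<open>q\<close> consisting of the pairs \<open>(i, q - i)\<close>
    in the order of \<open>i\<close>. Each word is written at the start of infinitely many blocks, hence also in
    one long enough to hold it.\<close>
  define u where "u n = (let (i, r) = prod_decode n; w = e (fst (prod_decode (i + r)))
    in if i < length w then w ! i else d)" for n
  have "u n \<in> D" for n
  proof -
    obtain i r where ir: "prod_decode n = (i, r)" by fastforce
    have "w ! i \<in> D" if "w = e (fst (prod_decode (i + r)))" "i < length w" for w
      using e[of "fst (prod_decode (i + r))"] that nth_mem[OF that(2)] by auto
    then show ?thesis using d by (simp add: u_def ir Let_def)
  qed
  moreover have "\<exists>p. \<forall>i<length ws. u (p + i) = ws ! i" if ws: "ws \<in> lists D" for ws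
  proof -
    obtain j where j: "e j = ws"
      using from_nat_into_surj[OF cl ws] unfolding e_def by blast
    \<comment> \<open>Block \<open>q\<close> carries the word \<open>e j\<close>, as
      \<open>j\<close> is the first component of \<open>prod_decode q\<close>. It is long enough
      because \<open>length ws \<le> q\<close>.\<close>
    define q where "q = prod_encode (j, length ws)"
    have "u (triangle q + i) = ws ! i" if "i < length ws" for i
    proof -
      have "i \<le> q" using that le_prod_encode_2[of "length ws" j] by (simp add: q_def)
      then have "triangle q + i = prod_encode (i, q - i)" by (simp add: prod_encode_def)
      then have "prod_decode (triangle q + i) = (i, q - i)" by simp
      then show ?thesis using \<open>i \<le> q\<close> that by (simp add: u_def q_def j)
    qed
    then show ?thesis by blast
  qed
  ultimately show ?thesis by blast
qed

text \<open>The complement makes the order come out right: a larger \<open>A\<close> admits fewer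
  colours, and groups with more colours preform those with fewer.\<close>

definition colours :: "nat set \<Rightarrow> nat set" where
  "colours A = {0, 1} \<union> enumerate {p. prime p} ` (- A)"

definition universal_colours :: "nat set \<Rightarrow> nat \<Rightarrow> nat" where
  "universal_colours A = (SOME u. range u \<subseteq> colours A \<and>
     (\<forall>ws\<in>lists (colours A). \<exists>p. \<forall>i<length ws. u (p + i) = ws ! i))"

definition colouring :: "nat set \<Rightarrow> nat set \<Rightarrow> int \<Rightarrow> nat" where
  "colouring A \<tau> k =
     (if k \<ge> 0 then universal_colours A (nat k) else if nat (- k - 1) \<in> \<tau> then 1 else 0)"

lemma universal_colours:
  shows "range (universal_colours A) \<subseteq> colours A"
    and "ws \<in> lists (colours A) \<Longrightarrow> \<exists>p. \<forall>i<length ws. universal_colours A (p + i) = ws ! i"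
proof -
  have "\<exists>u. range u \<subseteq> colours A \<and>
      (\<forall>ws\<in>lists (colours A). \<exists>p. \<forall>i<length ws. u (p + i) = ws ! i)"
    by (rule universal_sequence) (auto simp: colours_def)
  from someI_ex[OF this] show "range (universal_colours A) \<subseteq> colours A"
    and "ws \<in> lists (colours A) \<Longrightarrow> \<exists>p. \<forall>i<length ws. universal_colours A (p + i) = ws ! i"
    unfolding universal_colours_def by blast+
qed

lemma range_colouring: "range (colouring A \<tau>) = colours A"
proof (intro equalityI subsetI)
  fix d assume "d \<in> range (colouring A \<tau>)"
  then obtain k where d: "d = colouring A \<tau> k" by blast
  have "0 \<in> colours A" "1 \<in> colours A" by (simp_all add: colours_def)
  moreover have "universal_colours A (nat k) \<in> colours A" using universal_colours(1) by blast
  ultimately show "d \<in> colours A" by (simp add: d colouring_def)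
next
  fix d assume "d \<in> colours A"
  then obtain p where "universal_colours A p = d" using universal_colours(2)[of "[d]" A] by auto
  then have "colouring A \<tau> (int p) = d" by (simp add: colouring_def)
  then show "d \<in> range (colouring A \<tau>)" by blast
qed

lemma prime_enumerate: "prime (enumerate {p::nat. prime p} j)"
  using enumerate_in_set[OF primes_infinite] by blast

lemma colouring_values:
  "colouring A \<tau> k = 0 \<or> colouring A \<tau> k = 1 \<or> prime (colouring A \<tau> k)"
proof -
  have "colouring A \<tau> k \<in> colours A" using range_colouring by blast
  then show ?thesis using prime_enumerate by (auto simp: colours_def)
qed

lemma enumerate_prime_in_colours_iff: "enumerate {p::nat. prime p} j \<in> colours A \<longleftrightarrow> j \<notin> A"
proof -
  have "enumerate {p::nat. prime p} j \<noteq> 0" "enumerate {p::nat. prime p} j \<noteq> 1"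
    using prime_gt_1_nat[OF prime_enumerate[of j]] by linarith+
  moreover have "inj (enumerate {p::nat. prime p})"
    by (rule strict_mono_imp_inj_on[OF strict_mono_enumerate[OF primes_infinite]])
  ultimately show ?thesis by (auto simp: colours_def inj_eq)
qed

lemma colouring_approximation:
  assumes "A \<subseteq> A'"
  shows "\<exists>m. \<forall>k. \<bar>k\<bar> \<le> M \<longrightarrow> colouring A \<tau> (k + m) = colouring A' \<tau>' k"
proof -
  \<comment> \<open>The window \<open>[- M..M]\<close> of the second colouring is a word over
    \<open>colours A\<close>, so it occurs in the universal sequence.\<close>
  define ws where "ws = map (colouring A' \<tau>') [- M..M]"
  have "colours A' \<subseteq> colours A" using assms by (auto simp: colours_def)
  then have "range (colouring A' \<tau>') \<subseteq> colours A" by (simp only: range_colouring)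
  then have "colouring A' \<tau>' k \<in> colours A" for k by blast
  then have "ws \<in> lists (colours A)" by (auto simp: ws_def)
  then obtain p where p: "\<And>i. i < length ws \<Longrightarrow> universal_colours A (p + i) = ws ! i"
    using universal_colours(2) by blast
  \<comment> \<open>The copy starts at \<open>p\<close> and the window at \<open>- M\<close>, so the
    shift is by \<open>p + M\<close>.\<close>
  have "colouring A \<tau> (k + (int p + M)) = colouring A' \<tau>' k" if "\<bar>k\<bar> \<le> M" for k
  proof -
    define i where "i = nat (k + M)"
    have k: "k = int i - M" using that by (simp add: i_def)
    have i: "i < length ws" "i < length [- M..M]" using that by (auto simp: ws_def i_def)
    have "colouring A \<tau> (k + (int p + M)) = universal_colours A (p + i)"
      by (simp add: colouring_def k nat_add_distrib add.commute)
    also have "\<dots> = colouring A' \<tau>' ([- M..M] ! i)"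
      using p[OF i(1)] i(2) by (simp add: ws_def)
    also have "[- M..M] ! i = k" using that by (subst nth_upto) (auto simp: i_def)
    finally show ?thesis .
  qed
  then show ?thesis by blast
qed

text \<open>For \<open>j \<in> A\<close> the first group has no torsion at the \<open>j\<close>-th
  prime. Torsion of the second group would pass to the first, so the second has none either, which
  means \<open>j \<in> A'\<close>.\<close>

lemma preforms_colouring_iff:
  "preforms (hall_quotient (colouring A \<tau>)) (hall_quotient (colouring A' \<tau>')) \<longleftrightarrow> A \<subseteq> A'"
proof
  assume pre: "preforms (hall_quotient (colouring A \<tau>)) (hall_quotient (colouring A' \<tau>'))"
  show "A \<subseteq> A'"
  proof
    fix j assume "j \<in> A"
    have torsion: "has_torsion (hall_quotient (colouring B \<sigma>)) (enumerate {p. prime p} j) \<longleftrightarrow> j \<notin> B"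
      for B \<sigma>
      using has_torsion_hall_quotient_iff[of "colouring B \<sigma>", OF colouring_values prime_enumerate]
      unfolding range_colouring enumerate_prime_in_colours_iff by blast
    then show "j \<in> A'"
      using preforms_has_torsion[OF group_hall_quotient group_hall_quotient pre] \<open>j \<in> A\<close> by blast
  qed
qed (rule preforms_hall_quotient[OF colouring_approximation])

section \<open>Counting isomorphism classes\<close>

text \<open>The sets of naturals inject into the product of \<open>range f\<close> with
  \<open>nat\<close>, and an infinite set absorbs a countable factor. A finite
  \<open>range f\<close> would leave only countably many sets of naturals.\<close>

lemma nat_sets_lepoll_if_countable_fibres:
  fixes f :: "nat set \<Rightarrow> 'b" and g :: "nat set \<Rightarrow> nat"
  assumes inj: "inj (\<lambda>\<tau>. (f \<tau>, g \<tau>))"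
  shows "(UNIV :: nat set set) \<lesssim> range f"
proof -
  have le: "(UNIV :: nat set set) \<lesssim> range f \<times> (UNIV :: nat set)"
    unfolding lepoll_def using inj by (intro exI[of _ "\<lambda>\<tau>. (f \<tau>, g \<tau>)"]) auto
  have "infinite (range f)"
  proof
    assume "finite (range f)"
    then have "countable (range f \<times> (UNIV :: nat set))" by (simp add: countable_finite)
    then have "countable (UNIV :: nat set set)" using countable_lepoll le by blast
    then have "range (from_nat_into (UNIV :: nat set set)) = UNIV"
      by (intro range_from_nat_into) simp_all
    then show False using Cantors_theorem[of "UNIV :: nat set"] unfolding Pow_UNIV by blast
  qed
  then have "\<exists>h. bij_betw h (range f \<times> (UNIV :: nat set)) (range f)"
    using card_of_Times_infinite_simps(1)[OF _ UNIV_not_empty] infinite_iff_card_of_nat card_of_ordIso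
    by blast
  then have "range f \<times> (UNIV :: nat set) \<lesssim> range f"
    unfolding lepoll_def bij_betw_def by blast
  then show ?thesis using le lepoll_trans by blast
qed

text \<open>Both embeddings, composed with the projections, are homomorphisms from Hall's group that
  agree on its generators, hence everywhere. So they have the same kernel, and this contains the
  \<open>k\<close>-th central basis element iff the colour at \<open>k\<close> is 1.\<close>

lemma hall_quotient_iso_determines:
  assumes K: "group K" and h: "h \<in> hom (hall_quotient c) K" "inj_on h (carrier (hall_quotient c))"
    and h': "h' \<in> hom (hall_quotient c') K" "inj_on h' (carrier (hall_quotient c'))"
    and eq: "\<And>l. l < 3 \<Longrightarrow> h (hall_class c (hall_gen l)) = h' (hall_class c' (hall_gen l))"
  shows "c k = 1 \<longleftrightarrow> c' k = 1"
proof -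
  have kills: "hall_class c (0, 0, 0, frag_of k) = hall_class c (0, 0, 0, 0) \<longleftrightarrow> c k = 1" for c
    unfolding hall_class_eq_iff by auto
  have hom: "h \<circ> hall_class c \<in> hom hall_group K" "h' \<circ> hall_class c' \<in> hom hall_group K"
    using hom_compose[OF hall_class_hom h(1)] hom_compose[OF hall_class_hom h'(1)] .
  interpret P: group_hom hall_group K "h \<circ> hall_class c"
    using hom(1) K group_hall_group by (simp add: group_hom_def group_hom_axioms_def)
  interpret P': group_hom hall_group K "h' \<circ> hall_class c'"
    using hom(2) K group_hall_group by (simp add: group_hom_def group_hom_axioms_def)
  have agree: "h (hall_class c a) = h' (hall_class c' a)" for a
  proof -
    have "a \<in> generate hall_group (hall_gen ` {..<3})" by (simp add: hall_group_generated)
    then have "(h \<circ> hall_class c) a = (h' \<circ> hall_class c') a"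
    proof induction
      case (incl a)
      then show ?case using eq by auto
    next
      case (inv a)
      then have "(h \<circ> hall_class c) a = (h' \<circ> hall_class c') a" using eq by auto
      then show ?case using P.hom_inv[of a] P'.hom_inv[of a] by simp
    next
      case (eng a b)
      then show ?case using P.hom_mult[of a b] P'.hom_mult[of a b] by simp
    next
      case one
      then show ?case using P.hom_one P'.hom_one by simp
    qed
    then show ?thesis by simp
  qed
  have "hall_class c a = hall_class c b \<longleftrightarrow> hall_class c' a = hall_class c' b" for a b
    proof -
    have "hall_class c a = hall_class c b \<longleftrightarrow> h (hall_class c a) = h (hall_class c b)"
      using inj_on_eq_iff[OF h(2)] by (simp add: carrier_hall_quotient)
    also have "\<dots> \<longleftrightarrow> hall_class c' a = hall_class c' b"
      using inj_on_eq_iff[OF h'(2)] by (simp add: carrier_hall_quotient agree)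
    finally show ?thesis .
  qed
  from this[of "(0, 0, 0, frag_of k)" "(0, 0, 0, 0)"] show ?thesis
    unfolding kills .
qed

definition nat_copy :: "nat set \<Rightarrow> nat set \<Rightarrow> nat monoid" where
  "nat_copy A \<tau> = (SOME K. K \<in> fg_groups \<and> hall_quotient (colouring A \<tau>) \<cong> K)"

lemma nat_copy:
  "nat_copy A \<tau> \<in> fg_groups" "hall_quotient (colouring A \<tau>) \<cong> nat_copy A \<tau>"
proof -
  have "\<exists>K. K \<in> fg_groups \<and> hall_quotient (colouring A \<tau>) \<cong> K"
    using finitely_generated_group_has_nat_copy[OF finitely_generated_hall_quotient] by blast
  from someI_ex[OF this] show "nat_copy A \<tau> \<in> fg_groups"
    "hall_quotient (colouring A \<tau>) \<cong> nat_copy A \<tau>"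
    unfolding nat_copy_def by blast+
qed

lemma fg_groups_group: "G \<in> fg_groups \<Longrightarrow> group G"
  by (simp add: fg_groups_def finitely_generated_group_def)

lemma preforms_nat_copy_iff: "preforms (nat_copy A \<tau>) (nat_copy A' \<tau>') \<longleftrightarrow> A \<subseteq> A'"
proof -
  have iso: "nat_copy A \<tau> \<cong> hall_quotient (colouring A \<tau>)" for A \<tau>
    using group.iso_sym[OF group_hall_quotient nat_copy(2)] .
  have "preforms (nat_copy A \<tau>) (nat_copy A' \<tau>') \<longleftrightarrow>
      preforms (hall_quotient (colouring A \<tau>)) (hall_quotient (colouring A' \<tau>'))"
    using preforms_iso_cong[OF _ _ _ _ iso iso] preforms_iso_cong[OF _ _ _ _ nat_copy(2) nat_copy(2)]
      fg_groups_group[OF nat_copy(1)] group_hall_quotient by blast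
  then show ?thesis by (simp add: preforms_colouring_iff)
qed

text \<open>Each class comes from only countably many \<open>\<tau>\<close>: in a fixed
  representative, the images of the three generators determine \<open>\<tau>\<close>, and they form
  a triple of naturals.\<close>

lemma reals_lepoll_classes:
  "(UNIV :: real set) \<lesssim> range (\<lambda>\<tau>. fg_iso `` {nat_copy A \<tau>})" (is "_ \<lesssim> range ?cl")
proof -
  define rep where "rep C = (SOME K. K \<in> C)" for C :: "nat monoid set"
  have rep: "rep (?cl \<tau>) \<in> fg_groups" "hall_quotient (colouring A \<tau>) \<cong> rep (?cl \<tau>)" for \<tau>
  proof -
    have "nat_copy A \<tau> \<in> ?cl \<tau>" using nat_copy(1) by (auto simp: fg_iso_def intro: iso_refl)
    then have "rep (?cl \<tau>) \<in> ?cl \<tau>" unfolding rep_def by (rule someI)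
    moreover have "K \<in> fg_groups \<and> nat_copy A \<tau> \<cong> K" if "K \<in> ?cl \<tau>" for K
      using that by (simp add: fg_iso_def)
    ultimately have "rep (?cl \<tau>) \<in> fg_groups \<and> nat_copy A \<tau> \<cong> rep (?cl \<tau>)" by blast
    then show "rep (?cl \<tau>) \<in> fg_groups" "hall_quotient (colouring A \<tau>) \<cong> rep (?cl \<tau>)"
      using iso_trans[OF nat_copy(2)] by blast+
  qed
  define h where "h \<tau> = (SOME h. h \<in> iso (hall_quotient (colouring A \<tau>)) (rep (?cl \<tau>)))" for \<tau>
  have h: "h \<tau> \<in> iso (hall_quotient (colouring A \<tau>)) (rep (?cl \<tau>))" for \<tau>
    using rep(2)[of \<tau>] unfolding h_def is_iso_def by (rule some_in_eq[THEN iffD2])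
  define gen where "gen \<tau> l = h \<tau> (hall_class (colouring A \<tau>) (hall_gen l))" for \<tau> l
  define g where "g \<tau> = to_nat (gen \<tau> 0, gen \<tau> 1, gen \<tau> 2)" for \<tau>
  have "inj (\<lambda>\<tau>. (?cl \<tau>, g \<tau>))"
  proof (rule injI)
    fix \<sigma> \<tau> assume "(?cl \<sigma>, g \<sigma>) = (?cl \<tau>, g \<tau>)"
    then have cl: "?cl \<sigma> = ?cl \<tau>" and gen: "gen \<sigma> 0 = gen \<tau> 0" "gen \<sigma> 1 = gen \<tau> 1" "gen \<sigma> 2 = gen \<tau> 2"
      by (auto simp: g_def)
    have gen3: "gen \<sigma> l = gen \<tau> l" if "l < 3" for l
    proof -
      have "l = 0 \<or> l = 1 \<or> l = 2" using that by linarith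
      then show ?thesis using gen by blast
    qed
    have ones: "colouring A \<sigma> k = 1 \<longleftrightarrow> colouring A \<tau> k = 1" for k
    proof (rule hall_quotient_iso_determines)
      show "group (rep (?cl \<tau>))" using rep(1) by (rule fg_groups_group)
      show "h \<sigma> \<in> hom (hall_quotient (colouring A \<sigma>)) (rep (?cl \<tau>))"
        "inj_on (h \<sigma>) (carrier (hall_quotient (colouring A \<sigma>)))"
        using h[of \<sigma>] unfolding cl by (auto simp: iso_def bij_betw_def)
      show "h \<tau> \<in> hom (hall_quotient (colouring A \<tau>)) (rep (?cl \<tau>))"
        "inj_on (h \<tau>) (carrier (hall_quotient (colouring A \<tau>)))"
        using h[of \<tau>] by (auto simp: iso_def bij_betw_def)
      show "h \<sigma> (hall_class (colouring A \<sigma>) (hall_gen l)) =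
          h \<tau> (hall_class (colouring A \<tau>) (hall_gen l))" if "l < 3" for l
        using gen3[OF that] by (simp add: gen_def)
    qed
    have "i \<in> \<sigma> \<longleftrightarrow> i \<in> \<tau>" for i
      using ones[of "- int i - 1"] by (simp add: colouring_def split: if_split_asm)
    then show "\<sigma> = \<tau>" by blast
  qed
  then have "(UNIV :: nat set set) \<lesssim> range ?cl" by (rule nat_sets_lepoll_if_countable_fibres)
  then show ?thesis
    using nat_sets_eqpoll_reals eqpoll_imp_lepoll eqpoll_sym lepoll_trans by blast
qed

lemma nat_monoids_lepoll_reals: "(UNIV :: nat monoid set) \<lesssim> (UNIV :: real set)"
proof -
  define E where "E G = (\<lambda>a. (0::nat, a, 0, 0)) ` carrier G \<union>
    range (\<lambda>(a, b). (1, a, b, a \<otimes>\<^bsub>G\<^esub> b)) \<union> {(2, \<one>\<^bsub>G\<^esub>, 0, 0)}" for G :: "nat monoid"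
  have mem: "a \<in> carrier G \<longleftrightarrow> (0, a, 0, 0) \<in> E G" "x = a \<otimes>\<^bsub>G\<^esub> b \<longleftrightarrow> (1, a, b, x) \<in> E G"
    "a = \<one>\<^bsub>G\<^esub> \<longleftrightarrow> (2, a, 0, 0) \<in> E G" for G :: "nat monoid" and a b x
    by (auto simp: image_iff E_def)
  have "inj (\<lambda>G. to_nat ` E G)"
  proof (rule injI)
    fix G H :: "nat monoid" assume "to_nat ` E G = to_nat ` E H"
    then have "E G = E H" by (simp only: inj_image_eq_iff[OF inj_to_nat])
    then have "a \<in> carrier G \<longleftrightarrow> a \<in> carrier H" "x = a \<otimes>\<^bsub>G\<^esub> b \<longleftrightarrow> x = a \<otimes>\<^bsub>H\<^esub> b"
      "a = \<one>\<^bsub>G\<^esub> \<longleftrightarrow> a = \<one>\<^bsub>H\<^esub>" for a b x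
      by (simp_all only: mem)
    then have "carrier G = carrier H" "monoid.mult G = monoid.mult H" "one G = one H"
      by (blast, metis ext, metis)
    then show "G = H" by simp
  qed
  then have "(UNIV :: nat monoid set) \<lesssim> (UNIV :: nat set set)"
    unfolding lepoll_def by blast
  then show ?thesis using nat_sets_eqpoll_reals eqpoll_imp_lepoll lepoll_trans by blast
qed

lemma fg_classes_lepoll_reals: "fg_classes \<lesssim> (UNIV :: real set)"
proof -
  have "fg_classes = (\<lambda>G. fg_iso `` {G}) ` fg_groups"
    by (auto simp: fg_classes_def quotient_def)
  then have "fg_classes \<lesssim> fg_groups" using image_lepoll by metis
  also have "fg_groups \<lesssim> (UNIV :: nat monoid set)" by (simp add: subset_imp_lepoll)
  also note nat_monoids_lepoll_reals
  finally show ?thesis .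
qed

section \<open>The order on isomorphism classes, coded by sets of naturals\<close>

lemma fg_class_in_fg_classes: "G \<in> fg_groups \<Longrightarrow> fg_iso `` {G} \<in> fg_classes"
  by (simp add: fg_classes_def quotientI)

lemma preforms_classes_iff:
  assumes "G \<in> fg_groups" "H \<in> fg_groups"
  shows "(fg_iso `` {G}, fg_iso `` {H}) \<in> preforms_classes \<longleftrightarrow> preforms G H"
proof
  assume "(fg_iso `` {G}, fg_iso `` {H}) \<in> preforms_classes"
  then obtain G' H' where G': "G' \<in> fg_groups" "G \<cong> G'" and H': "H' \<in> fg_groups" "H \<cong> H'"
    and "preforms G' H'"
    by (auto simp: preforms_classes_def fg_iso_def)
  moreover from this have "G' \<cong> G" "H' \<cong> H"
    using assms group.iso_sym fg_groups_group by blast+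
  ultimately show "preforms G H"
    using preforms_iso_cong assms fg_groups_group by blast
next
  assume "preforms G H"
  moreover have "G \<in> fg_iso `` {G}" "H \<in> fg_iso `` {H}"
    using assms by (auto simp: fg_iso_def intro: iso_refl)
  ultimately show "(fg_iso `` {G}, fg_iso `` {H}) \<in> preforms_classes"
    using assms fg_class_in_fg_classes by (auto simp: preforms_classes_def)
qed

lemma preforms_classes_order_code:
  "\<exists>\<nu> :: nat monoid set \<Rightarrow> nat set. \<forall>C\<in>fg_classes. \<forall>D\<in>fg_classes.
     (C, D) \<in> preforms_classes \<longleftrightarrow> \<nu> C \<subseteq> \<nu> D"
proof -
  obtain enc :: "pattern \<Rightarrow> nat" where enc: "inj_on enc (UNIV \<times> UNIV \<times> Collect finite)"
    using countable_patterns by (auto simp: countable_def)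
  define rep where "rep C = (SOME G. G \<in> fg_groups \<and> C = fg_iso `` {G})" for C
  have rep: "rep C \<in> fg_groups" "fg_iso `` {rep C} = C" if "C \<in> fg_classes" for C
  proof -
    have "\<exists>G. G \<in> fg_groups \<and> C = fg_iso `` {G}"
      using that by (auto simp: fg_classes_def quotient_def)
    from someI_ex[OF this] show "rep C \<in> fg_groups" "fg_iso `` {rep C} = C"
      unfolding rep_def by blast+
  qed
  \<comment> \<open>Complements, since \<open>preforms\<close> reverses the inclusion of
    patterns.\<close>
  define \<nu> where "\<nu> C = - (enc ` patterns (rep C))" for C
  have "(C, D) \<in> preforms_classes \<longleftrightarrow> \<nu> C \<subseteq> \<nu> D" if "C \<in> fg_classes" "D \<in> fg_classes" for C D
  proof -
    have "(C, D) \<in> preforms_classes \<longleftrightarrow> preforms (rep C) (rep D)"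
      using preforms_classes_iff[OF rep(1)[OF that(1)] rep(1)[OF that(2)]]
      by (simp add: rep(2) that)
    also have "\<dots> \<longleftrightarrow> patterns (rep D) \<subseteq> patterns (rep C)"
      using rep(1) that by (intro preforms_iff_patterns fg_groups_group) (auto simp: fg_groups_def)
    also have "\<dots> \<longleftrightarrow> enc ` patterns (rep D) \<subseteq> enc ` patterns (rep C)"
      unfolding image_subset_iff
      using inj_on_image_mem_iff[OF enc _ patterns_subset] patterns_subset[of "rep D"] by blast
    finally show ?thesis by (auto simp: \<nu>_def)
  qed
  then show ?thesis by blast
qed

section \<open>Both directions of the imbedding criterion for preorders\<close>

theorem theorem2:
  fixes X :: "'a set" and r :: "'a rel"
  assumes "preorder_on X r"
  shows "preorder_imbeds X r fg_classes preforms_classes \<longleftrightarrow>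
    X \<lesssim> (UNIV :: real set) \<and>
    (\<exists>B :: nat set. countable B \<and>
       (\<forall>Y. Y \<subseteq> X \<and> antisym_on Y r \<longrightarrow>
          preorder_imbeds Y (Restr r Y) (Pow B) (inclusion_on B)))"
proof
  assume "preorder_imbeds X r fg_classes preforms_classes"
  then obtain f where "inj_on f X \<and> f ` X \<subseteq> fg_classes \<and>
      (\<forall>x\<in>X. \<forall>y\<in>X. (x, y) \<in> r \<longleftrightarrow> (f x, f y) \<in> preforms_classes)"
    unfolding preorder_imbeds_def by (elim exE) (rule that)
  then have f: "inj_on f X" "f ` X \<subseteq> fg_classes"
    and ord: "\<And>x y. x \<in> X \<Longrightarrow> y \<in> X \<Longrightarrow> (x, y) \<in> r \<longleftrightarrow> (f x, f y) \<in> preforms_classes"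
    by simp_all
  obtain \<nu> :: "nat monoid set \<Rightarrow> nat set" where
    \<nu>: "\<And>C D. C \<in> fg_classes \<Longrightarrow> D \<in> fg_classes \<Longrightarrow> (C, D) \<in> preforms_classes \<longleftrightarrow> \<nu> C \<subseteq> \<nu> D"
    using preforms_classes_order_code by blast
  have code: "(x, y) \<in> r \<longleftrightarrow> \<nu> (f x) \<subseteq> \<nu> (f y)" if "x \<in> X" "y \<in> X" for x y
    using \<nu> ord f(2) that by blast
  have "X \<lesssim> fg_classes" unfolding lepoll_def using f by blast
  then have "X \<lesssim> (UNIV :: real set)" using fg_classes_lepoll_reals lepoll_trans by blast
  moreover have "preorder_imbeds Y (Restr r Y) (Pow UNIV) (inclusion_on (UNIV :: nat set))"
    if Y: "Y \<subseteq> X" "antisym_on Y r" for Y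
  proof -
    \<comment> \<open>Equal codes only say that \<open>x\<close> and \<open>y\<close> are related
      both ways; antisymmetry on \<open>Y\<close> turns this into equality.\<close>
    have "inj_on (\<lambda>x. \<nu> (f x)) Y"
    proof (rule inj_onI)
      fix x y assume xy: "x \<in> Y" "y \<in> Y" "\<nu> (f x) = \<nu> (f y)"
      then have "x \<in> X" "y \<in> X" using Y(1) by blast+
      then have "(x, y) \<in> r" "(y, x) \<in> r" using code xy(3) by blast+
      then show "x = y" using Y(2) xy by (simp add: antisym_on_def)
    qed
    moreover have "(x, y) \<in> Restr r Y \<longleftrightarrow> (\<nu> (f x), \<nu> (f y)) \<in> inclusion_on UNIV"
      if "x \<in> Y" "y \<in> Y" for x y
      using code that Y(1) by (auto simp: inclusion_on_def)
    ultimately show ?thesis unfolding preorder_imbeds_def by (intro exI[of _ "\<lambda>x. \<nu> (f x)"]) auto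
  qed
  ultimately show "X \<lesssim> (UNIV :: real set) \<and> (\<exists>B :: nat set. countable B \<and>
      (\<forall>Y. Y \<subseteq> X \<and> antisym_on Y r \<longrightarrow> preorder_imbeds Y (Restr r Y) (Pow B) (inclusion_on B)))"
    by (intro conjI exI[of _ UNIV]) auto
next
  assume R: "X \<lesssim> (UNIV :: real set) \<and> (\<exists>B :: nat set. countable B \<and>
      (\<forall>Y. Y \<subseteq> X \<and> antisym_on Y r \<longrightarrow> preorder_imbeds Y (Restr r Y) (Pow B) (inclusion_on B)))"
  \<comment> \<open>The cardinality assumption supplies real labels, which will separate equivalent
    elements of \<open>X\<close>.\<close>
  obtain \<iota> :: "'a \<Rightarrow> real" where \<iota>: "inj_on \<iota> X"
    using conjunct1[OF R] unfolding lepoll_def by blast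
  obtain B :: "nat set" where "countable B \<and> (\<forall>Y. Y \<subseteq> X \<and> antisym_on Y r \<longrightarrow>
      preorder_imbeds Y (Restr r Y) (Pow B) (inclusion_on B))"
    using conjunct2[OF R] by (elim exE) (rule that)
  then have B: "preorder_imbeds Y (Restr r Y) (Pow B) (inclusion_on B)"
    if "Y \<subseteq> X" "antisym_on Y r" for Y
    using that by simp
  have refl: "(x, x) \<in> r" if "x \<in> X" for x
    using assms that by (auto simp: preorder_on_def refl_on_def)
  have trans: "(x, z) \<in> r" if "(x, y) \<in> r" "(y, z) \<in> r" for x y z
    using assms that by (auto simp: preorder_on_def dest: transD)
  define rep where "rep x = (SOME y. y \<in> X \<and> (x, y) \<in> r \<and> (y, x) \<in> r)" for x
  have rep: "rep x \<in> X" "(x, rep x) \<in> r" "(rep x, x) \<in> r" if "x \<in> X" for x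
    using someI[of "\<lambda>y. y \<in> X \<and> (x, y) \<in> r \<and> (y, x) \<in> r" x] refl[OF that] that
    unfolding rep_def by blast+
  have rep_eq: "rep x = rep y" if "(x, y) \<in> r" "(y, x) \<in> r" for x y
  proof -
    have "(\<lambda>z. z \<in> X \<and> (x, z) \<in> r \<and> (z, x) \<in> r) = (\<lambda>z. z \<in> X \<and> (y, z) \<in> r \<and> (z, y) \<in> r)"
      using trans that by blast
    then show ?thesis unfolding rep_def by (rule arg_cong)
  qed
  have "antisym_on (rep ` X) r"
    unfolding antisym_on_def
  proof (intro ballI impI)
    fix u v assume "u \<in> rep ` X" "v \<in> rep ` X" and uv: "(u, v) \<in> r" "(v, u) \<in> r"
    then obtain x y where x: "x \<in> X" "u = rep x" and y: "y \<in> X" "v = rep y" by blast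
    have "(x, y) \<in> r" "(y, x) \<in> r" using rep[OF x(1)] rep[OF y(1)] uv x(2) y(2) trans by blast+
    then show "u = v" using rep_eq x(2) y(2) by blast
  qed
  moreover have "rep ` X \<subseteq> X" using rep(1) by blast
  ultimately have "preorder_imbeds (rep ` X) (Restr r (rep ` X)) (Pow B) (inclusion_on B)"
    by (intro B)
  then obtain g :: "'a \<Rightarrow> nat set" where "inj_on g (rep ` X) \<and> g ` rep ` X \<subseteq> Pow B \<and>
      (\<forall>u\<in>rep ` X. \<forall>v\<in>rep ` X. (u, v) \<in> Restr r (rep ` X) \<longleftrightarrow> (g u, g v) \<in> inclusion_on B)"
    unfolding preorder_imbeds_def by (elim exE) (rule that)
  then have g: "\<And>u v. u \<in> rep ` X \<Longrightarrow> v \<in> rep ` X \<Longrightarrow>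
        (u, v) \<in> Restr r (rep ` X) \<longleftrightarrow> (g u, g v) \<in> inclusion_on B"
      and gB: "g ` rep ` X \<subseteq> Pow B"
    by blast+
  define A where "A x = g (rep x)" for x
  have A: "(x, y) \<in> r \<longleftrightarrow> A x \<subseteq> A y" if "x \<in> X" "y \<in> X" for x y
  proof -
    have "(x, y) \<in> r \<longleftrightarrow> (rep x, rep y) \<in> r"
      using rep[OF that(1)] rep[OF that(2)] trans by blast
    also have "\<dots> \<longleftrightarrow> A x \<subseteq> A y"
      using g[of "rep x" "rep y"] gB that by (auto simp: A_def inclusion_on_def)
    finally show ?thesis .
  qed
  \<comment> \<open>For every set \<open>A\<close> there are continuum many classes of groups coded
    by \<open>A\<close>, enough to spread out a whole equivalence class of \<open>X\<close>.\<close>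
  have "\<exists>e. inj (e :: real \<Rightarrow> nat monoid set) \<and> range e \<subseteq> range (\<lambda>\<tau>. fg_iso `` {nat_copy A \<tau>})" for A
    using reals_lepoll_classes[of A] unfolding lepoll_def by blast
  then obtain e where e: "\<And>A. inj (e A :: real \<Rightarrow> nat monoid set)"
      "\<And>A. range (e A) \<subseteq> range (\<lambda>\<tau>. fg_iso `` {nat_copy A \<tau>})"
    by metis
  have "\<exists>\<tau>. e A \<rho> = fg_iso `` {nat_copy A \<tau>}" for A \<rho> using e(2)[of A] by blast
  then obtain \<tau> where \<tau>: "\<And>A \<rho>. e A \<rho> = fg_iso `` {nat_copy A (\<tau> A \<rho>)}" by metis
  \<comment> \<open>The set \<open>A x\<close> takes care of the order and the label
    \<open>\<iota> x\<close> of injectivity.\<close>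
  define f where "f x = e (A x) (\<iota> x)" for x
  have f: "f x \<in> fg_classes" for x
    unfolding f_def \<tau> by (rule fg_class_in_fg_classes[OF nat_copy(1)])
  have f_le: "(f x, f y) \<in> preforms_classes \<longleftrightarrow> A x \<subseteq> A y" for x y
    unfolding f_def \<tau> preforms_classes_iff[OF nat_copy(1) nat_copy(1)] by (rule preforms_nat_copy_iff)
  have "inj_on f X"
  proof (rule inj_onI)
    fix x y assume xy: "x \<in> X" "y \<in> X" "f x = f y"
    then have "A x = A y" using f_le[of x y] f_le[of y x] f_le[of x x] by auto
    then have "\<iota> x = \<iota> y" using xy(3) injD[OF e(1)] by (simp add: f_def)
    then show "x = y" using \<iota> xy by (simp add: inj_on_def)
  qed
  then show "preorder_imbeds X r fg_classes preforms_classes"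
    unfolding preorder_imbeds_def using f f_le A by (intro exI[of _ f]) auto
qed

end
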